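(* Let $a,v:[0,\infty)\to[0,\infty)$ be continuous, strictly increasing functions, regularly varying at infinity with indices $A>0$ and $V>0$ respectively, and put $a_n=a(n)$, $v_n=v(n)$ and $h=v\circ a^{-1}$. Let $W=\{W_n:n\in\mathbb N\}$, $\mathbb N=\{0,1,2,\dots\}$, be a sequence of real random variables with $W_0=0$ satisfying the following hypotheses. 1. (Restricted LDP) There is a function $J_W:[0,\infty)\to[0,\infty]$ such that for every $q\ge 0$ $$\lim_{n\to\infty}\frac1{v_n}\log\mathbb P\left(\frac{W_n}{a_n}>q\right)=-J_W(q).$$ 2. (Stability and continuity) $J_W(0)>0$; there is $y>0$ with $J_W(y)<\infty$; and $J_W$ is continuous on the interior of $\{x: J_W(x)<\infty\}$. 3. (Uniform individual decay rate) For a fixed $q>0$ there exist constants $F=F(q)>V/A$ and $K=K(q)>0$ such that for all $n\in\mathbb N$ and all $c>K$ $$\frac1{v_n}\log\mathbb P\left(\frac{W_n}{a_n}>cq\right)\le -c^F.$$ Let $k_{J_W}=\inf_{c>0}c^{-V/A}J_W(c)$, and define $\tilde I_W:\mathbb R\to[0,\infty]$ by $\tilde I_W(x)=k_{J_W}x^{V/A}$ for $x\ge 0$ and $\tilde I_W(x)=\infty$ for $x<0$. For $u>0$ let $\mu_u^W$ be the probability measure on $\mathbb R$ defined by $\mu_u^W(\Gamma)=\mathbb P(\exists n\in\mathbb N: W_n\in u\Gamma)$ for Borel sets $\Gamma\subseteq\mathbb R$. Then the family $\{\mu_u^W\}$ satisfies the large deviation principle on $\mathbb R$ with speed function $h$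 and good rate function $\tilde I_W$. That is, $\tilde I_W$ is lower semicontinuous, is not identically $\infty$, and has compact level sets $\{x:\tilde I_W(x)\le r\}$ for every $r\ge 0$; and for every Borel set $\Gamma\subseteq\mathbb R$, with interior $\Gamma^\circ$ and closure $\bar\Gamma$, $$-\inf_{x\in\Gamma^\circ}\tilde I_W(x)\le\liminf_{u\to\infty}\frac1{h(u)}\log\mu_u^W(\Gamma)\le\limsup_{u\to\infty}\frac1{h(u)}\log\mu_u^W(\Gamma)\le-\inf_{x\in\bar\Gamma}\tilde I_W(x).$$
   Context: A function $f$ is regularly varying at infinity with index $\rho$ if $\lim_{t\to\infty}f(ct)/f(t)=c^\rho$ for every $c>0$. The inverse $a^{-1}$ is defined on the range of $a$, which contains all sufficiently large $u$, so $h(u)$ is defined for all large $u$. If $a_0=0$ or $v_0=0$, the inequality in hypothesis 3 for $n=0$ is read in the form $\mathbb P(W_n>c\,a_nq)\le e^{-v_nc^F}$. Conventions: $\log 0=-\infty$, $\inf\emptyset=+\infty$, and $u\Gamma=\{ux:x\in\Gamma\}$.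
   Formalization: P(∃n: W_n∈uΓ) is not additive in Γ, so the LDP is proved for the probability measures agreeing with it on half-lines (x,∞) (law of sup W_n/u); for the formula itself the lower bound is for all Borel Γ, the upper bound only if Γ⊆[0,∞) or 0 lies in the closure of Γ. *)

theory Defs
  imports "HOL-Probability.Probability"
begin

definition regularly_varying :: "(real \<Rightarrow> real) \<Rightarrow> real \<Rightarrow> bool" where
  "regularly_varying f \<rho> \<longleftrightarrow>
     (\<forall>c>0. ((\<lambda>t. f (c * t) / f t) \<longlongrightarrow> c powr \<rho>) at_top)"

text \<open>Logarithm of a probability, with \<open>log 0 = -\<infinity>\<close> (the library's real \<open>ln\<close> has \<open>ln 0 = 0\<close>).\<close>

definition log_prob :: "real \<Rightarrow> ereal" where
  "log_prob p = (if p \<le> 0 then - \<infinity> else ereal (ln p))"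

text \<open>\<open>h = v \<circ> a\<^sup>-\<^sup>1\<close>, where \<open>a\<close> is injective on \<open>[0,\<infinity>)\<close>;
  the value is meaningful for \<open>u\<close> in the range \<open>a ` [0,\<infinity>)\<close>, hence for all large \<open>u\<close>.\<close>

definition ldp_speed :: "(real \<Rightarrow> real) \<Rightarrow> (real \<Rightarrow> real) \<Rightarrow> real \<Rightarrow> real" where
  "ldp_speed a v u = v (the_inv_into {0..} a u)"

definition restricted_LDP ::
  "'s measure \<Rightarrow> (nat \<Rightarrow> 's \<Rightarrow> real) \<Rightarrow> (real \<Rightarrow> real) \<Rightarrow> (real \<Rightarrow> real) \<Rightarrow> (real \<Rightarrow> ereal) \<Rightarrow> bool" where
  "restricted_LDP M W a v J \<longleftrightarrow>
     (\<forall>q\<ge>0. (\<lambda>n. ereal (1 / v (real n)) *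
                 log_prob (measure M {\<omega> \<in> space M. W n \<omega> / a (real n) > q}))
             \<longlonglongrightarrow> - J q)"

text \<open>The interior is taken in the real line. The point \<open>0\<close> is thus excluded, which is
  the weaker of the two possible continuity requirements on a function on \<open>[0,\<infinity>)\<close>.\<close>

definition stable_and_continuous :: "(real \<Rightarrow> ereal) \<Rightarrow> bool" where
  "stable_and_continuous J \<longleftrightarrow>
     J 0 > 0 \<and> (\<exists>y>0. J y < \<infinity>) \<and> continuous_on (interior {x. 0 \<le> x \<and> J x < \<infinity>}) J"

text \<open>Only the index \<open>n = 0\<close> can have \<open>a n = 0\<close> or \<open>v n = 0\<close>; there the inequality
  is read in the form without divisions.\<close>

definition uniform_individual_decay ::
  "'s measure \<Rightarrow> (nat \<Rightarrow> 's \<Rightarrow> real) \<Rightarrow> (real \<Rightarrow> real) \<Rightarrow> (real \<Rightarrow> real)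
     \<Rightarrow> real \<Rightarrow> real \<Rightarrow> real \<Rightarrow> bool" where
  "uniform_individual_decay M W a v q F K \<longleftrightarrow>
     (\<forall>n. \<forall>c>K.
        if a (real n) = 0 \<or> v (real n) = 0
        then measure M {\<omega> \<in> space M. W n \<omega> > c * a (real n) * q}
               \<le> exp (- (v (real n) * c powr F))
        else ereal (1 / v (real n)) *
               log_prob (measure M {\<omega> \<in> space M. W n \<omega> / a (real n) > c * q})
               \<le> ereal (- (c powr F)))"

definition rate_const :: "real \<Rightarrow> real \<Rightarrow> (real \<Rightarrow> ereal) \<Rightarrow> ereal" where
  "rate_const A V J = (INF c\<in>{0<..}. ereal (c powr (- (V / A))) * J c)"

definition rate_fun :: "real \<Rightarrow> real \<Rightarrow> (real \<Rightarrow> ereal) \<Rightarrow> real \<Rightarrow> ereal" where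
  "rate_fun A V J x = (if 0 \<le> x then rate_const A V J * ereal (x powr (V / A)) else \<infinity>)"

text \<open>The probability that the process \<open>W\<close> visits \<open>u\<Gamma>\<close>. As a function of \<open>\<Gamma>\<close> this is not
  additive in general.\<close>

definition visit_prob :: "'s measure \<Rightarrow> (nat \<Rightarrow> 's \<Rightarrow> real) \<Rightarrow> real \<Rightarrow> real set \<Rightarrow> real" where
  "visit_prob M W u \<Gamma> = measure M {\<omega> \<in> space M. \<exists>n. W n \<omega> \<in> (\<lambda>x. u * x) ` \<Gamma>}"

text \<open>\<open>\<mu>\<close> is a family of Borel probability measures on the line with
  \<open>\<mu> u (\<Gamma>) = P(\<exists>n. W n \<in> u\<Gamma>)\<close> for the open half-lines \<open>\<Gamma> = (x,\<infinity>)\<close>. These determine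
  \<open>\<mu> u\<close>, which is the law of \<open>(sup n. W n) / u\<close> whenever the supremum is almost surely finite.
  The identity cannot be required for all Borel \<open>\<Gamma>\<close>: with \<open>W 0 = 0\<close> it would force every
  \<open>W n\<close> to vanish almost surely.\<close>

definition visit_measure ::
  "'s measure \<Rightarrow> (nat \<Rightarrow> 's \<Rightarrow> real) \<Rightarrow> (real \<Rightarrow> real measure) \<Rightarrow> bool" where
  "visit_measure M W \<mu> \<longleftrightarrow>
     (\<forall>u>0. prob_space (\<mu> u) \<and> sets (\<mu> u) = sets borel \<and>
        (\<forall>x. measure (\<mu> u) {x<..} = visit_prob M W u {x<..}))"

definition good_rate_function :: "(real \<Rightarrow> ereal) \<Rightarrow> bool" where
  "good_rate_function I \<longleftrightarrow>
     (\<forall>x. 0 \<le> I x) \<and>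
     (\<forall>x. I x \<le> Liminf (at x) I) \<and>
     (\<exists>x. I x \<noteq> \<infinity>) \<and>
     (\<forall>r\<ge>0. compact {x. I x \<le> ereal r})"

text \<open>The large deviation bounds are stated for a family of set functions \<open>P u\<close>, so that they
  apply both to measures and to the visiting probabilities.\<close>

definition LD_lower_bound ::
  "(real \<Rightarrow> real) \<Rightarrow> (real \<Rightarrow> ereal) \<Rightarrow> (real \<Rightarrow> real set \<Rightarrow> real) \<Rightarrow> real set \<Rightarrow> bool" where
  "LD_lower_bound h I P \<Gamma> \<longleftrightarrow>
     - (INF x\<in>interior \<Gamma>. I x) \<le> Liminf at_top (\<lambda>u. ereal (1 / h u) * log_prob (P u \<Gamma>))"

definition LD_upper_bound ::
  "(real \<Rightarrow> real) \<Rightarrow> (real \<Rightarrow> ereal) \<Rightarrow> (real \<Rightarrow> real set \<Rightarrow> real) \<Rightarrow> real set \<Rightarrow> bool" where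
  "LD_upper_bound h I P \<Gamma> \<longleftrightarrow>
     Liminf at_top (\<lambda>u. ereal (1 / h u) * log_prob (P u \<Gamma>))
       \<le> Limsup at_top (\<lambda>u. ereal (1 / h u) * log_prob (P u \<Gamma>)) \<and>
     Limsup at_top (\<lambda>u. ereal (1 / h u) * log_prob (P u \<Gamma>)) \<le> - (INF x\<in>closure \<Gamma>. I x)"

definition LDP ::
  "(real \<Rightarrow> real) \<Rightarrow> (real \<Rightarrow> ereal) \<Rightarrow> (real \<Rightarrow> real measure) \<Rightarrow> bool" where
  "LDP h I \<mu> \<longleftrightarrow>
     good_rate_function I \<and>
     (\<forall>\<Gamma>\<in>sets borel. LD_lower_bound h I (\<lambda>u. measure (\<mu> u)) \<Gamma> \<and>
                   LD_upper_bound h I (\<lambda>u. measure (\<mu> u)) \<Gamma>)"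

end

theory Submission
  imports Defs
begin

text \<open>Write \<open>p = V / A\<close>. For \<open>u = a t\<close> the speed is \<open>h u = v t\<close>, and \<open>W n\<close> exceeds \<open>u\<close> when
  \<open>W n / a n\<close> exceeds \<open>c = u / a n\<close>, which costs about \<open>J c * v n\<close>. Regular variation turns
  \<open>u = c * a n\<close> into \<open>v n \<approx> c powr (- p) * h u\<close>, so that the cost of reaching \<open>u\<close> at the time
  attached to \<open>c\<close> is \<open>c powr (- p) * J c * h u\<close>. The cheapest time decides:
  \<open>P(\<exists>n. W n > u)\<close> decays like \<open>exp (- \<kappa> * h u)\<close>, where \<open>\<kappa>\<close> is the infimum of
  \<open>c powr (- p) * J c\<close>. Since \<open>h\<close> is itself regularly varying with index \<open>p\<close>, replacing \<open>u\<close> by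
  \<open>x * u\<close> multiplies the exponent by \<open>x powr p\<close>, which is the rate function.

  The constant \<open>\<kappa>\<close> lies strictly between \<open>0\<close> and \<open>\<infinity>\<close>: for small \<open>c\<close> the lower bound comes
  from \<open>J 0 > 0\<close>, for large \<open>c\<close> from the uniform decay, whose exponent \<open>F\<close> exceeds \<open>p\<close>
  (\<open>J_power_lower_bound\<close>).

  The upper bound (\<open>hit_upper_time\<close>) is a union bound over \<open>n\<close>, split according to \<open>n / t\<close>. Times
  \<open>n \<le> \<delta> * t\<close> with small \<open>\<delta>\<close> are too early: uniform decay with \<open>F > p\<close> makes their exponents as large as
  desired. Times \<open>n > R * t\<close> with large \<open>R\<close> are too late: already \<open>W n > 0\<close> costs a fixed
  multiple of \<open>v n\<close>, hence a large multiple of \<open>v t\<close>, with a summable remainder. On the compact range of \<open>n / t\<close>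
  in between, \<open>J c \<ge> \<kappa> * c powr p\<close> bounds every term; there are only \<open>O(t)\<close> of them, a factor
  that is subexponential in \<open>v t\<close>.

  The lower bound (\<open>window_lower_unit\<close>) has to produce a visit to a short interval around \<open>u\<close>,
  not merely beyond it. Let \<open>c\<close> nearly minimise \<open>c powr (- p) * J c\<close> and let \<open>d > 1\<close>. The
  inequality \<open>J (d * c) \<ge> \<kappa> * (d * c) powr p\<close> forces \<open>J (d * c)\<close> to be strictly larger than
  \<open>J c\<close> as soon as \<open>c\<close> is close enough to being a minimiser. So exceeding
  \<open>d * c * a n\<close> is exponentially less likely than exceeding \<open>c * a n\<close>, and at the time \<open>n\<close> with
  \<open>c * a n \<approx> u\<close> the variable \<open>W n\<close> lands in the interval at cost about \<open>\<kappa> * h u\<close>.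

  Finally, the required measures are the laws of \<open>(sup n. W n) / u\<close>. The supremum is almost surely
  finite because \<open>P(\<exists>n. W n > u)\<close> tends to \<open>0\<close>, and almost surely nonnegative because
  \<open>W 0 = 0\<close>. For Borel sets, \<open>LD_lower_boundI\<close> and \<open>LD_upper_boundI\<close> reduce both the laws and
  the visiting probabilities to windows and half-lines.\<close>

section \<open>Probabilities on the logarithmic scale\<close>

lemma powr_inverse_powr:
  fixes y p :: real
  assumes "0 \<le> y" "0 < p"
  shows "(y powr (1 / p)) powr p = y"
  using assms by (simp add: powr_powr)

text \<open>These equivalences trade the extended-real normalised logarithms, including the value \<open>- \<infinity>\<close> at
  probability \<open>0\<close>, for real inequalities between probabilities and exponentials; all estimates
  below are made in the latter form.\<close>

lemma log_rate_le_iff: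
  assumes "h > 0"
  shows "ereal (1 / h) * log_prob p \<le> ereal (- \<theta>) \<longleftrightarrow> p \<le> exp (- (\<theta> * h))"
proof (cases "p \<le> 0")
  case True
  then have "p \<le> exp (- (\<theta> * h))" by (meson exp_ge_zero order_trans)
  with True assms show ?thesis by (simp add: log_prob_def)
next
  case False
  then have "ln p / h \<le> - \<theta> \<longleftrightarrow> ln p \<le> - (\<theta> * h)"
    using assms by (simp add: divide_le_eq)
  also have "\<dots> \<longleftrightarrow> p \<le> exp (- (\<theta> * h))" using False by (metis exp_le_cancel_iff exp_ln not_le)
  finally show ?thesis using False by (simp add: log_prob_def)
qed

lemma log_rate_ge_iff:
  assumes "h > 0"
  shows "ereal (- \<theta>) \<le> ereal (1 / h) * log_prob p \<longleftrightarrow> exp (- (\<theta> * h)) \<le> p"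
proof (cases "p \<le> 0")
  case True
  then have "\<not> exp (- (\<theta> * h)) \<le> p" using exp_gt_zero[of "- (\<theta> * h)"] by linarith
  with True assms show ?thesis by (simp add: log_prob_def)
next
  case False
  then have "- \<theta> \<le> ln p / h \<longleftrightarrow> - (\<theta> * h) \<le> ln p"
    using assms by (simp add: le_divide_eq)
  also have "\<dots> \<longleftrightarrow> exp (- (\<theta> * h)) \<le> p" using False by (simp add: ln_ge_iff not_le)
  finally show ?thesis using False by (simp add: log_prob_def)
qed

lemma log_prob_mono: "p \<le> p' \<Longrightarrow> log_prob p \<le> log_prob p'"
  by (auto simp: log_prob_def)

text \<open>Subtracting a probability of strictly smaller exponential order does not change the rate. This is
  how the probability of a window is obtained from those of two half-lines.\<close>

lemma eventually_exp_le_diff: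
  fixes g :: "'b \<Rightarrow> real"
  assumes "filterlim g at_top F" "\<alpha> < \<beta>" "\<alpha> < \<theta>"
  shows "\<forall>\<^sub>F u in F. exp (- (\<theta> * g u)) \<le> exp (- (\<alpha> * g u)) - exp (- (\<beta> * g u))"
proof -
  define m where "m = min \<theta> \<beta>"
  have m: "\<alpha> < m" "m \<le> \<theta>" "m \<le> \<beta>" using assms by (auto simp: m_def)
  have "\<forall>\<^sub>F u in F. max 0 (ln 2 / (m - \<alpha>)) \<le> g u"
    using assms(1) unfolding filterlim_at_top by blast
  then show ?thesis
  proof eventually_elim
    case (elim u)
    then have g: "0 \<le> g u" "ln 2 / (m - \<alpha>) \<le> g u" by auto
    have "ln 2 \<le> (m - \<alpha>) * g u" using g(2) m by (simp add: field_simps)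
    then have "exp (ln 2) * exp (- (m * g u)) \<le> exp ((m - \<alpha>) * g u) * exp (- (m * g u))"
      by (intro mult_right_mono) (simp_all only: exp_le_cancel_iff exp_ge_zero)
    also have "\<dots> = exp (- (\<alpha> * g u))" by (simp add: exp_add[symmetric] algebra_simps)
    finally have "2 * exp (- (m * g u)) \<le> exp (- (\<alpha> * g u))" by simp
    moreover have "exp (- (\<theta> * g u)) \<le> exp (- (m * g u))" "exp (- (\<beta> * g u)) \<le> exp (- (m * g u))"
      using m g by (auto intro!: mult_right_mono)
    ultimately show ?case by linarith
  qed
qed

section \<open>Regularly varying functions\<close>

lemma regularly_varying_powr:
  assumes "regularly_varying f \<rho>" and "\<And>t. t > 0 \<Longrightarrow> 0 < f t"
  shows "regularly_varying (\<lambda>t. f t powr r) (\<rho> * r)"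
  unfolding regularly_varying_def
proof (intro allI impI)
  fix c :: real assume c: "c > 0"
  have "((\<lambda>t. (f (c * t) / f t) powr r) \<longlongrightarrow> (c powr \<rho>) powr r) at_top"
    using assms(1) c by (intro tendsto_intros) (auto simp: regularly_varying_def)
  moreover have "\<forall>\<^sub>F t in at_top. (f (c * t) / f t) powr r = f (c * t) powr r / f t powr r"
    using eventually_gt_at_top[of 0]
    by eventually_elim (use assms(2) c in \<open>simp add: powr_divide less_imp_le\<close>)
  ultimately show "((\<lambda>t. f (c * t) powr r / f t powr r) \<longlongrightarrow> c powr (\<rho> * r)) at_top"
    by (simp add: powr_powr filterlim_cong)
qed

lemma regularly_varying_power_function: "regularly_varying (\<lambda>t. t powr r) r"
  unfolding regularly_varying_def
proof (intro allI impI)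
  fix c :: real assume c: "c > 0"
  have "\<forall>\<^sub>F t in at_top. c powr r = (c * t) powr r / t powr r"
    using eventually_gt_at_top[of 0]
    by eventually_elim (use c in \<open>simp add: powr_mult less_imp_le\<close>)
  then show "((\<lambda>t. (c * t) powr r / t powr r) \<longlongrightarrow> c powr r) at_top"
    by (rule Lim_transform_eventually[OF tendsto_const])
qed

lemma regularly_varying_const: "c \<noteq> 0 \<Longrightarrow> regularly_varying (\<lambda>_. c) 0"
  unfolding regularly_varying_def by auto

text \<open>The weak form of Potter's bounds that is needed here. Doubling \<open>t\<close> eventually multiplies
  \<open>r = f / g\<close> by at most some \<open>\<rho> < 1\<close>, because the limit of that factor is
  \<open>2 powr (\<alpha> - \<beta>)\<close>; between consecutive doublings the monotonicity of \<open>f\<close> and \<open>g\<close> costs only a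
  bounded factor \<open>C\<close>. Hence \<open>r\<close> at \<open>t\<close> is smaller than \<open>r\<close> at \<open>s\<close> by any prescribed factor once
  \<open>t / s\<close> is large, uniformly in \<open>s\<close>. Below the threshold \<open>T0\<close> for \<open>s\<close>, monotonicity bounds
  \<open>r s\<close> away from \<open>0\<close> and it suffices that \<open>t\<close> is large.\<close>

lemma regularly_varying_quotient_gap:
  fixes f g :: "real \<Rightarrow> real"
  assumes f: "mono_on {0<..} f" "\<And>t. t > 0 \<Longrightarrow> 0 < f t" "regularly_varying f \<alpha>"
    and g: "mono_on {0<..} g" "\<And>t. t > 0 \<Longrightarrow> 0 < g t" "regularly_varying g \<beta>"
    and "\<alpha> < \<beta>" and "D > 0"
  shows "\<exists>\<delta>>0. \<exists>T. \<forall>s\<ge>1. \<forall>t\<ge>T. s \<le> \<delta> * t \<longrightarrow> D * (f t / g t) \<le> f s / g s"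
proof -
  define r where "r = (\<lambda>t. f t / g t)"
  have rpos: "0 < r t" if "t > 0" for t using f(2) g(2) that by (simp add: r_def)
  have f2: "((\<lambda>t. f (2 * t) / f t) \<longlongrightarrow> 2 powr \<alpha>) at_top"
    and g2: "((\<lambda>t. g (2 * t) / g t) \<longlongrightarrow> 2 powr \<beta>) at_top"
    using f(3) g(3) by (auto simp: regularly_varying_def)
  \<comment> \<open>Any number strictly between the limiting factor and \<open>1\<close> would do.\<close>
  define \<rho> where "\<rho> = ((2::real) powr (\<alpha> - \<beta>) + 1) / 2"
  have "(2::real) powr (\<alpha> - \<beta>) < 1" using \<open>\<alpha> < \<beta>\<close> by (simp add: powr_less_one)
  then have \<rho>: "2 powr (\<alpha> - \<beta>) < \<rho>" "0 < \<rho>" "\<rho> < 1"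
    unfolding \<rho>_def using powr_gt_zero[of 2 "\<alpha> - \<beta>"] by (auto simp del: powr_gt_zero)
  have "((\<lambda>t. (f (2 * t) / f t) / (g (2 * t) / g t)) \<longlongrightarrow> 2 powr \<alpha> / 2 powr \<beta>) at_top"
    by (intro tendsto_divide f2 g2) simp
  then have "\<forall>\<^sub>F t in at_top. (f (2 * t) / f t) / (g (2 * t) / g t) < \<rho>"
    using \<rho> by (intro order_tendstoD(2)) (auto simp: powr_diff)
  moreover define C where "C = (2::real) powr \<alpha> + 1"
  then have "\<forall>\<^sub>F t in at_top. f (2 * t) / f t < C"
    by (intro order_tendstoD(2)[OF f2]) auto
  ultimately have "\<forall>\<^sub>F t in at_top. (f (2 * t) / f t) / (g (2 * t) / g t) < \<rho> \<and> f (2 * t) / f t < C"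
    by (rule eventually_conj)
  then obtain T1 where T1: "\<And>t. t \<ge> T1 \<Longrightarrow> (f (2 * t) / f t) / (g (2 * t) / g t) < \<rho> \<and> f (2 * t) / f t < C"
    by (auto simp: eventually_at_top_linorder)
  define T0 where "T0 = max T1 1"
  have T0: "T0 \<ge> 1" by (simp add: T0_def)
  have "C > 0" by (simp add: C_def add_nonneg_pos)
  have double: "r (2 * t) \<le> \<rho> * r t" if "t \<ge> T0" for t
  proof -
    have p: "f t > 0" "g t > 0" "g (2*t) > 0" "f (2 * t) > 0" using f g that T0 by auto
    have "(f (2 * t) / f t) / (g (2 * t) / g t) < \<rho>" using T1[of t] that by (simp add: T0_def)
    with p show ?thesis by (simp add: r_def field_simps)
  qed
  have local: "r t \<le> C * r s" if "s \<ge> T0" "s \<le> t" "t \<le> 2 * s" for s t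
  proof -
    have p: "f s > 0" "g s > 0" "g t > 0" "f t > 0" using f g that T0 by auto
    have "f (2 * s) / f s < C" using T1[of s] that by (simp add: T0_def)
    then have "f (2 * s) \<le> C * f s" using p by (simp add: field_simps)
    moreover have "f t \<le> f (2 * s)" by (rule mono_onD[OF f(1)]) (use that T0 in auto)
    ultimately have "f t \<le> C * f s" by simp
    moreover have "g s \<le> g t" by (rule mono_onD[OF g(1)]) (use that T0 in auto)
    ultimately have "f t / g t \<le> (C * f s) / g s" using p \<open>C > 0\<close> by (intro frac_le) auto
    then show ?thesis by (simp add: r_def)
  qed
  have global_aux: "\<forall>t. s \<le> t \<longrightarrow> t < 2 ^ i * s \<longrightarrow> r t \<le> C * r s" if "s \<ge> T0" for s i
  proof (induction i)
    case (Suc i)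
    show ?case
    proof (intro allI impI)
      fix t assume t: "s \<le> t" "t < 2 ^ Suc i * s"
      show "r t \<le> C * r s"
      proof (cases "t \<le> 2 * s")
        case False
        then have "s \<le> t / 2" "t / 2 < 2 ^ i * s" using t by auto
        then have *: "r (t / 2) \<le> C * r s" using Suc by blast
        have "r t \<le> \<rho> * r (t / 2)" using double[of "t/2"] that False by simp
        also have "\<dots> \<le> 1 * r (t / 2)"
          using rpos[of "t/2"] \<rho> that T0 t by (intro mult_right_mono) auto
        finally show ?thesis using * by simp
      qed (use local that t in auto)
    qed
  qed auto
  have global: "r t \<le> C * r s" if "s \<ge> T0" "s \<le> t" for s t
  proof -
    obtain i where "t / s < 2 ^ i" using real_arch_pow[of 2 "t/s"] by auto
    then have "t < 2 ^ i * s" using that T0 by (simp add: field_simps)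
    then show ?thesis using global_aux[OF that(1), of i] that by blast
  qed
  have shift: "r (2 ^ j * t) \<le> \<rho> ^ j * r t" if "t \<ge> T0" for j t
  proof (induction j)
    case (Suc j)
    have "1 * t \<le> 2 ^ j * t" using that T0 by (intro mult_right_mono) auto
    then have "r (2 * (2 ^ j * t)) \<le> \<rho> * r (2 ^ j * t)" using that by (intro double) auto
    also have "\<dots> \<le> \<rho> * (\<rho> ^ j * r t)" using Suc \<rho> by (intro mult_left_mono) auto
    finally show ?case by (simp add: mult.assoc)
  qed simp
  have decay: "r t \<le> \<rho> ^ j * C * r s" if "s \<ge> T0" "2 ^ j * s \<le> t" for s t j
  proof -
    have st: "s \<le> t / 2 ^ j" using that by (simp add: field_simps)
    then have "r t \<le> \<rho> ^ j * r (t / 2 ^ j)" using shift[of "t / 2 ^ j" j] that by simp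
    also have "\<dots> \<le> \<rho> ^ j * (C * r s)"
      using global[OF that(1) st] \<rho> by (intro mult_left_mono) auto
    finally show ?thesis by (simp add: mult.assoc)
  qed
  have small: "\<exists>j. \<rho> ^ j * K \<le> e" if K: "K > 0" "e > 0" for K e :: real
  proof -
    obtain j where "\<rho> ^ j < e / K"
      using real_arch_pow_inv[OF divide_pos_pos[OF K(2,1)] \<rho>(3)] by blast
    with K show ?thesis by (intro exI[of _ j]) (simp add: field_simps)
  qed
  obtain j where j: "\<rho> ^ j * (D * C) \<le> 1" using small[of "D * C" 1] \<open>C > 0\<close> \<open>D > 0\<close> by auto
  define m where "m = f 1 / g T0"
  have "m > 0" using f(2)[of 1] g(2)[of T0] T0 by (simp add: m_def)
  obtain i where i: "\<rho> ^ i * (D * C * r T0) \<le> m"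
    using small[of "D * C * r T0" m] \<open>C > 0\<close> \<open>D > 0\<close> \<open>m > 0\<close> rpos[of T0] T0 by auto
  have "D * r t \<le> r s" if st: "s \<ge> 1" "t \<ge> 2 ^ i * T0" "s \<le> t / 2 ^ j" for s t
  proof (cases "s \<ge> T0")
    case True
    have "r t \<le> \<rho> ^ j * C * r s" using st True by (intro decay) (auto simp: field_simps)
    then have "D * r t \<le> D * (\<rho> ^ j * C * r s)" using \<open>D > 0\<close> by simp
    also have "\<dots> = (\<rho> ^ j * (D * C)) * r s" by simp
    also have "\<dots> \<le> 1 * r s" using j rpos[of s] st by (intro mult_right_mono) auto
    finally show ?thesis by simp
  next
    case False
    have "r t \<le> \<rho> ^ i * C * r T0" using st by (intro decay) auto
    then have "D * r t \<le> D * (\<rho> ^ i * C * r T0)" using \<open>D > 0\<close> by simp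
    also have "\<dots> = \<rho> ^ i * (D * C * r T0)" by simp
    also have "\<dots> \<le> m" by (rule i)
    also have "\<dots> \<le> r s" unfolding m_def r_def
    proof (rule frac_le)
      show "f 1 \<le> f s" by (rule mono_onD[OF f(1)]) (use st in auto)
      show "g s \<le> g T0" by (rule mono_onD[OF g(1)]) (use st False in auto)
    qed (use f(2)[of s] g(2)[of s] st in auto)
    finally show ?thesis .
  qed
  then show ?thesis unfolding r_def
    by (intro exI[of _ "1 / 2 ^ j"] conjI exI[of _ "2 ^ i * T0"]) auto
qed

text \<open>The gap between \<open>f\<close> and the power function of a smaller index, read off at \<open>s = 1\<close>.\<close>

lemma regularly_varying_dominates_powr:
  fixes f :: "real \<Rightarrow> real"
  assumes f: "mono_on {0<..} f" "\<And>t. t > 0 \<Longrightarrow> 0 < f t" "regularly_varying f \<rho>"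
    and r: "0 \<le> r" "r < \<rho>"
  shows "\<exists>c>0. \<forall>\<^sub>F t in at_top. c * t powr r \<le> f t"
proof -
  have "mono_on {0<..} (\<lambda>t::real. t powr r)"
    using r by (auto intro!: mono_onI powr_mono2)
  from regularly_varying_quotient_gap[OF this _ regularly_varying_power_function f r(2), of 1]
  obtain \<delta> T where \<delta>: "\<delta> > 0"
    and T: "\<And>s t. s \<ge> 1 \<Longrightarrow> t \<ge> T \<Longrightarrow> s \<le> \<delta> * t \<Longrightarrow> t powr r / f t \<le> s powr r / f s"
    by auto
  have "\<forall>\<^sub>F t in at_top. f 1 * t powr r \<le> f t"
    using eventually_ge_at_top[of T] eventually_ge_at_top[of "1/\<delta>"] eventually_gt_at_top[of 0]
  proof eventually_elim
    case (elim t)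
    then have "t powr r / f t \<le> 1 powr r / f 1"
      using \<delta> by (intro T) (auto simp: field_simps)
    then show ?case using f(2)[of t] f(2)[of 1] elim by (simp add: field_simps)
  qed
  then show ?thesis using f(2)[of 1] by auto
qed

lemma powr_eventually_below:
  assumes "mono_on {0<..} f" "\<And>t. t > 0 \<Longrightarrow> 0 < f t" "regularly_varying f \<rho>" "\<rho> > 0"
  obtains c where "c > 0" "\<forall>\<^sub>F t in at_top. c * t powr (\<rho> / 2) \<le> f t"
  using regularly_varying_dominates_powr[OF assms(1,2,3), of "\<rho>/2"] assms(4) by auto

lemma filterlim_at_top_if_regularly_varying:
  assumes f: "mono_on {0<..} f" "\<And>t. t > 0 \<Longrightarrow> 0 < f t" "regularly_varying f \<rho>" "\<rho> > 0"
  shows "filterlim f at_top at_top"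
proof -
  obtain c where c: "c > 0" and le: "\<forall>\<^sub>F t in at_top. c * t powr (\<rho> / 2) \<le> f t"
    using powr_eventually_below[OF f] by blast
  have "filterlim (\<lambda>t. c * t powr (\<rho> / 2)) at_top at_top"
    using c assms(4) by (intro filterlim_tendsto_pos_mult_at_top[OF tendsto_const] real_powr_at_top) auto
  then show ?thesis using le by (rule filterlim_at_top_mono)
qed

text \<open>For monotone functions the defining limit is stable under perturbation of the argument: \<open>y\<close> is
  squeezed between \<open>c * z\<close> for constants \<open>c\<close> on both sides of \<open>s\<close>. It applies to times rounded to
  integers and to arguments that are values of the inverse scaling function.\<close>

lemma regularly_varying_ratio_limit:
  fixes f :: "real \<Rightarrow> real"
  assumes f: "mono_on {0..} f" "\<And>t. t > 0 \<Longrightarrow> 0 < f t" "regularly_varying f \<rho>"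
    and \<rho>: "\<rho> > 0" and z: "filterlim z at_top F"
    and yz: "((\<lambda>u. y u / z u) \<longlongrightarrow> s) F" and s: "s > 0"
  shows "((\<lambda>u. f (y u) / f (z u)) \<longlongrightarrow> s powr \<rho>) F"
proof -
  have ratio: "((\<lambda>u. f (c * z u) / f (z u)) \<longlongrightarrow> c powr \<rho>) F" if "c > 0" for c
    using f(3) that unfolding regularly_varying_def by (auto intro: filterlim_compose[OF _ z])
  have zpos: "\<forall>\<^sub>F u in F. z u > 0" using z by (auto simp: filterlim_at_top_dense)
  have root: "(l powr (1 / \<rho>)) powr \<rho> = l" if "l > 0" for l :: real
    using that \<rho> by (simp add: powr_powr)
  have lt: "b powr (1/\<rho>) < c powr (1/\<rho>)" if "0 \<le> b" "b < c" for b c :: real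
    using that \<rho> by (intro powr_less_mono2) auto
  have sroot: "(s powr \<rho>) powr (1/\<rho>) = s" using s \<rho> by (simp add: powr_powr)
  show ?thesis
  proof (rule order_tendstoI)
    fix l assume l: "l < s powr \<rho>"
    define l' where "l' = (max l 0 + s powr \<rho>) / 2"
    have l': "l < l'" "0 < l'" "l' < s powr \<rho>" using l s powr_gt_zero[of s \<rho>]
      by (auto simp: l'_def max_def simp del: powr_gt_zero)
    define c where "c = l' powr (1 / \<rho>)"
    have c: "c > 0" "c < s" "c powr \<rho> = l'"
      using l' lt[of l' "s powr \<rho>"] root[of l'] sroot by (auto simp: c_def)
    have "\<forall>\<^sub>F u in F. c < y u / z u" using order_tendstoD(1)[OF yz c(2)] .
    moreover have "\<forall>\<^sub>F u in F. l < f (c * z u) / f (z u)"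
      using order_tendstoD(1)[OF ratio[OF c(1)]] c l' by auto
    ultimately show "\<forall>\<^sub>F u in F. l < f (y u) / f (z u)" using zpos
    proof eventually_elim
      case (elim u)
      then have "c * z u \<le> y u" by (simp add: field_simps)
      then have "f (c * z u) \<le> f (y u)" using mult_pos_pos[OF c(1) elim(3)]
        by (intro mono_onD[OF f(1)]) auto
      then have "f (c * z u) / f (z u) \<le> f (y u) / f (z u)"
        using f(2)[OF elim(3)] by (intro divide_right_mono) auto
      with elim show ?case by linarith
    qed
  next
    fix l assume l: "l > s powr \<rho>"
    define l' where "l' = (l + s powr \<rho>) / 2"
    have l': "l' < l" "0 < l'" "l' > s powr \<rho>"
      using l s powr_gt_zero[of s \<rho>] by (auto simp: l'_def simp del: powr_gt_zero)
    define c where "c = l' powr (1 / \<rho>)"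
    have c: "c > 0" "c > s" "c powr \<rho> = l'"
      using l' lt[of "s powr \<rho>" l'] root[of l'] sroot by (auto simp: c_def)
    have "\<forall>\<^sub>F u in F. c > y u / z u" using order_tendstoD(2)[OF yz c(2)] .
    moreover have "\<forall>\<^sub>F u in F. 0 < y u / z u" using order_tendstoD(1)[OF yz s] .
    moreover have "\<forall>\<^sub>F u in F. l > f (c * z u) / f (z u)"
      using order_tendstoD(2)[OF ratio[OF c(1)]] c l' by auto
    ultimately show "\<forall>\<^sub>F u in F. l > f (y u) / f (z u)" using zpos
    proof eventually_elim
      case (elim u)
      then have "y u \<le> c * z u" "0 < y u" by (auto simp: field_simps zero_less_divide_iff)
      then have "f (y u) \<le> f (c * z u)"
        by (intro mono_onD[OF f(1)]) auto
      then have "f (y u) / f (z u) \<le> f (c * z u) / f (z u)"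
        using f(2)[OF elim(4)] by (intro divide_right_mono) auto
      with elim show ?case by linarith
    qed
  qed
qed

text \<open>Choosing \<open>m\<close> with \<open>m * r \<ge> 2\<close>, the bound follows from \<open>exp x = exp (x / m) ^ m \<ge> (x / m) ^ m\<close>.\<close>

lemma square_le_exp_powr:
  fixes e r :: real
  assumes "e > 0" "r > 0"
  shows "\<exists>K>0. \<forall>t\<ge>1. K * t ^ 2 \<le> exp (e * t powr r)"
proof -
  obtain m :: nat where m: "2 / r < real m" using reals_Archimedean2 by blast
  then have "m > 0" using assms by (cases m) (auto simp: divide_less_0_iff)
  have "(e / m) ^ m * t ^ 2 \<le> exp (e * t powr r)" if "t \<ge> 1" for t
  proof -
    have "t ^ 2 = t powr 2" using that by simp
    also have "\<dots> \<le> t powr (r * m)"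
      using that m assms by (intro powr_mono) (auto simp: field_simps)
    also have "\<dots> = (t powr r) ^ m" using that by (simp add: powr_powr [symmetric] powr_realpow)
    finally have "(e / m) ^ m * t ^ 2 \<le> (e / m) ^ m * (t powr r) ^ m"
      using assms by (intro mult_left_mono) auto
    also have "\<dots> = (e * t powr r / m) ^ m" by (simp add: power_mult_distrib power_divide)
    also have "\<dots> \<le> exp (e * t powr r / m) ^ m"
    proof (rule power_mono)
      show "e * t powr r / m \<le> exp (e * t powr r / m)"
        using exp_ge_add_one_self[of "e * t powr r / m"] by linarith
    qed (use assms in auto)
    also have "\<dots> = exp (e * t powr r)"
      using \<open>m > 0\<close> by (simp add: exp_of_nat_mult [symmetric])
    finally show ?thesis .
  qed
  then show ?thesis using assms \<open>m > 0\<close> by (intro exI[of _ "(e / m) ^ m"]) auto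
qed

lemma summable_exp_neg_powr:
  fixes e r :: real
  assumes "e > 0" "r > 0"
  shows "summable (\<lambda>n. exp (- (e * real n powr r)))"
proof -
  obtain K where K: "K > 0" "\<And>t. t \<ge> 1 \<Longrightarrow> K * t ^ 2 \<le> exp (e * t powr r)"
    using square_le_exp_powr[OF assms] by blast
  show ?thesis
  proof (rule summable_comparison_test'[where N = 1])
    show "summable (\<lambda>n. (1 / K) * inverse (real n ^ 2))"
      by (intro summable_mult inverse_power_summable) simp
    fix n :: nat assume "n \<ge> 1"
    then have "0 < K * real n ^ 2" "K * real n ^ 2 \<le> exp (e * real n powr r)"
      using K by auto
    then have "inverse (exp (e * real n powr r)) \<le> inverse (K * real n ^ 2)"
      by (intro le_imp_inverse_le) auto
    then show "norm (exp (- (e * real n powr r))) \<le> (1 / K) * inverse (real n ^ 2)"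
      by (simp add: exp_minus inverse_eq_divide)
  qed
qed

lemma linear_le_exp_powr:
  fixes b c e r :: real
  assumes "e > 0" "r > 0"
  shows "\<forall>\<^sub>F t in at_top. b * t + c \<le> exp (e * t powr r)"
proof -
  obtain K where K: "K > 0" "\<And>t. t \<ge> 1 \<Longrightarrow> K * t ^ 2 \<le> exp (e * t powr r)"
    using square_le_exp_powr[OF assms] by blast
  show ?thesis
    using eventually_ge_at_top[of 1] eventually_ge_at_top[of "(\<bar>b\<bar> + \<bar>c\<bar>) / K"]
  proof eventually_elim
    case (elim t)
    have "b * t \<le> \<bar>b\<bar> * t" "c \<le> \<bar>c\<bar> * t"
      using elim mult_left_mono[of 1 t "\<bar>c\<bar>"] by (auto intro!: mult_right_mono)
    then have "b * t + c \<le> (\<bar>b\<bar> + \<bar>c\<bar>) * t" by (simp add: algebra_simps)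
    also have "\<dots> \<le> (K * t) * t"
      using elim K(1) by (intro mult_right_mono) (auto simp: field_simps)
    also have "\<dots> \<le> exp (e * t powr r)" using K(2)[of t] elim by (simp add: power2_eq_square mult.assoc)
    finally show ?case .
  qed
qed

lemma filterlim_scale_at_top: "x > 0 \<Longrightarrow> filterlim (\<lambda>u::real. x * u) at_top at_top"
  by (intro filterlim_tendsto_pos_mult_at_top[OF tendsto_const] filterlim_ident)

lemma interior_window:
  fixes x :: real
  assumes "x \<in> interior \<Gamma>" "0 < x"
  obtains y z where "0 \<le> y" "y < x" "x < z" "{y<..<z} \<subseteq> \<Gamma>"
proof -
  obtain e where e: "e > 0" "ball x e \<subseteq> \<Gamma>" using assms mem_interior by blast
  have "{max 0 (x - e)<..<x + e} \<subseteq> ball x e" by (auto simp: dist_real_def)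
  then show ?thesis using that[of "max 0 (x - e)" "x + e"] e assms by auto
qed

section \<open>The inverse scaling function and the speed\<close>

locale scaling_pair =
  fixes a v :: "real \<Rightarrow> real" and A V :: real
  assumes a_cont: "continuous_on {0..} a"
    and a_strict_mono: "strict_mono_on {0..} a" and a_nonneg: "\<And>t. 0 \<le> t \<Longrightarrow> 0 \<le> a t"
    and v_strict_mono: "strict_mono_on {0..} v" and v_nonneg: "\<And>t. 0 \<le> t \<Longrightarrow> 0 \<le> v t"
    and A_pos: "A > 0" and a_rv: "regularly_varying a A"
    and V_pos: "V > 0" and v_rv: "regularly_varying v V"
begin

abbreviation \<tau> :: "real \<Rightarrow> real" where "\<tau> \<equiv> the_inv_into {0..} a"
abbreviation h :: "real \<Rightarrow> real" where "h \<equiv> ldp_speed a v"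

lemma a_pos: "t > 0 \<Longrightarrow> 0 < a t"
  using strict_mono_onD[OF a_strict_mono, of 0 t] a_nonneg[of 0] by simp

lemma v_pos: "t > 0 \<Longrightarrow> 0 < v t"
  using strict_mono_onD[OF v_strict_mono, of 0 t] v_nonneg[of 0] by simp

lemma a_mono_on: "mono_on {0..} a" and v_mono_on: "mono_on {0..} v"
  using a_strict_mono v_strict_mono by (auto intro: strict_mono_on_imp_mono_on)

lemma a_mono: "0 \<le> s \<Longrightarrow> s \<le> t \<Longrightarrow> a s \<le> a t"
  using mono_onD[OF a_mono_on, of s t] by simp

lemma v_mono: "0 \<le> s \<Longrightarrow> s \<le> t \<Longrightarrow> v s \<le> v t"
  using mono_onD[OF v_mono_on, of s t] by simp

lemma a_mono_on_pos: "mono_on {0<..} a" and v_mono_on_pos: "mono_on {0<..} v"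
  using a_mono_on v_mono_on by (auto intro: mono_on_subset)

lemma a_at_top: "filterlim a at_top at_top"
  using filterlim_at_top_if_regularly_varying[OF a_mono_on_pos a_pos a_rv A_pos] .

lemma v_at_top: "filterlim v at_top at_top"
  using filterlim_at_top_if_regularly_varying[OF v_mono_on_pos v_pos v_rv V_pos] .

lemma tau_nonneg: "u \<ge> a 0 \<Longrightarrow> 0 \<le> \<tau> u"
  and a_tau: "u \<ge> a 0 \<Longrightarrow> a (\<tau> u) = u"
proof -
  assume u: "u \<ge> a 0"
  have "\<forall>\<^sub>F t in at_top. u \<le> a t" using a_at_top by (auto simp: filterlim_at_top)
  then obtain t0 where "\<And>t. t \<ge> t0 \<Longrightarrow> u \<le> a t" by (auto simp: eventually_at_top_linorder)
  then obtain t where t: "u \<le> a t" "0 \<le> t" using max.cobounded1 max.cobounded2 by metis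
  have "continuous_on {0..t} a" by (rule continuous_on_subset[OF a_cont]) auto
  then have "\<exists>s\<ge>0. s \<le> t \<and> a s = u" using u t by (intro IVT') auto
  then have "u \<in> a ` {0..}" by auto
  moreover have "inj_on a {0..}" using a_strict_mono by (rule strict_mono_on_imp_inj_on)
  ultimately show "0 \<le> \<tau> u" "a (\<tau> u) = u"
    using the_inv_into_into[of a "{0..}" u "{0..}"] f_the_inv_into_f[of a "{0..}" u] by auto
qed

lemma less_tauI: "u \<ge> a 0 \<Longrightarrow> 0 \<le> s \<Longrightarrow> a s < u \<Longrightarrow> s < \<tau> u"
  using a_mono[of "\<tau> u" s] tau_nonneg[of u] a_tau[of u] by force

lemma tau_lessI: "u \<ge> a 0 \<Longrightarrow> 0 \<le> s \<Longrightarrow> u < a s \<Longrightarrow> \<tau> u < s"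
  using a_mono[of s "\<tau> u"] tau_nonneg[of u] a_tau[of u] by force

lemma tau_at_top: "filterlim \<tau> at_top at_top"
  unfolding filterlim_at_top
proof
  fix T :: real
  show "\<forall>\<^sub>F u in at_top. T \<le> \<tau> u"
    using eventually_gt_at_top[of "a (max T 0)"]
  proof eventually_elim
    case (elim u)
    then show ?case using less_tauI[of u "max T 0"] a_mono[of 0 "max T 0"] by force
  qed
qed

lemma tau_eventually: "\<forall>\<^sub>F u in at_top. 0 < \<tau> u \<and> a (\<tau> u) = u"
  using eventually_ge_at_top[of "a 0"] tau_at_top[unfolded filterlim_at_top_dense, rule_format, of 0]
  by eventually_elim (auto simp: a_tau)

lemma speed_eq: "h u = v (\<tau> u)"
  by (simp add: ldp_speed_def)

lemma speed_pos: "\<forall>\<^sub>F u in at_top. 0 < h u"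
  using tau_eventually by eventually_elim (simp add: speed_eq v_pos)

lemma speed_at_top: "filterlim h at_top at_top"
  unfolding ldp_speed_def by (rule filterlim_compose[OF v_at_top tau_at_top])

text \<open>The inverse is regularly varying with index \<open>1 / A\<close>. If \<open>s powr A < x\<close> then eventually
  \<open>a (s * \<tau> u) < x * u = a (\<tau> (x * u))\<close>, so that \<open>s * \<tau> u < \<tau> (x * u)\<close>; symmetrically from above.\<close>

lemma tau_ratio:
  assumes x: "x > 0"
  shows "((\<lambda>u. \<tau> (x * u) / \<tau> u) \<longlongrightarrow> x powr (1 / A)) at_top"
proof -
  have ratio: "((\<lambda>u. a (s * \<tau> u) / a (\<tau> u)) \<longlongrightarrow> s powr A) at_top" if "s > 0" for s
    using a_rv that unfolding regularly_varying_def by (auto intro: filterlim_compose[OF _ tau_at_top])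
  have root: "(x powr (1 / A)) powr A = x" using x A_pos by (simp add: powr_powr)
  have ev: "\<forall>\<^sub>F u in at_top. a 0 \<le> x * u"
    using filterlim_scale_at_top[OF x] by (auto simp: filterlim_at_top)
  show ?thesis
  proof (rule order_tendstoI)
    fix l assume l: "l < x powr (1 / A)"
    define s where "s = (max l 0 + x powr (1 / A)) / 2"
    have s: "l < s" "0 < s" "s < x powr (1 / A)"
      using l x powr_gt_zero[of x "1 / A"] by (auto simp: s_def max_def simp del: powr_gt_zero)
    have "s powr A < x" using powr_less_mono2[OF A_pos _ s(3)] s root by simp
    with ratio[OF s(2)] have "\<forall>\<^sub>F u in at_top. a (s * \<tau> u) / a (\<tau> u) < x"
      by (rule order_tendstoD)
    then show "\<forall>\<^sub>F u in at_top. l < \<tau> (x * u) / \<tau> u" using tau_eventually ev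
    proof eventually_elim
      case (elim u)
      then have "a (s * \<tau> u) < x * u" using a_pos[of "\<tau> u"] by (simp add: field_simps)
      then have "s * \<tau> u < \<tau> (x * u)" using elim s by (intro less_tauI) auto
      then have "s < \<tau> (x * u) / \<tau> u" using elim by (simp add: field_simps)
      with s show ?case by simp
    qed
  next
    fix s assume s: "s > x powr (1 / A)"
    then have s0: "0 < s" using powr_gt_zero[of x "1/A"] x by linarith
    have "s powr A > x" using powr_less_mono2[OF A_pos _ s] root by simp
    with ratio[OF s0] have "\<forall>\<^sub>F u in at_top. a (s * \<tau> u) / a (\<tau> u) > x"
      by (rule order_tendstoD)
    then show "\<forall>\<^sub>F u in at_top. s > \<tau> (x * u) / \<tau> u" using tau_eventually ev
    proof eventually_elim
      case (elim u)
      then have "a (s * \<tau> u) > x * u" using a_pos[of "\<tau> u"] by (simp add: field_simps)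
      then have "s * \<tau> u > \<tau> (x * u)" using elim s0 by (intro tau_lessI) auto
      then show ?case using elim by (simp add: field_simps)
    qed
  qed
qed

lemma speed_ratio:
  assumes x: "x > 0"
  shows "((\<lambda>u. h (x * u) / h u) \<longlongrightarrow> x powr (V / A)) at_top"
proof -
  have "((\<lambda>u. v (\<tau> (x * u)) / v (\<tau> u)) \<longlongrightarrow> (x powr (1 / A)) powr V) at_top"
    by (rule regularly_varying_ratio_limit[OF v_mono_on v_pos v_rv V_pos tau_at_top tau_ratio[OF x]])
      (use x in auto)
  then show ?thesis by (simp add: speed_eq powr_powr)
qed

lemma exponent_pos: "V / A > 0"
  using A_pos V_pos by simp

lemma summable_exp_neg_v:
  assumes "e > 0"
  shows "summable (\<lambda>n. exp (- (e * v (real n))))"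
proof -
  obtain c where c: "c > 0" and le: "\<forall>\<^sub>F t in at_top. c * t powr (V / 2) \<le> v t"
    using powr_eventually_below[OF v_mono_on_pos v_pos v_rv V_pos] by blast
  have "\<forall>\<^sub>F n in sequentially. c * real n powr (V / 2) \<le> v (real n)"
    using eventually_compose_filterlim[OF le filterlim_real_sequentially] .
  then have "\<forall>\<^sub>F n in sequentially. norm (exp (- (e * v (real n)))) \<le> exp (- (e * c * real n powr (V / 2)))"
    by eventually_elim (use assms in \<open>simp add: mult.assoc\<close>)
  then show ?thesis
    by (rule summable_comparison_test_ev) (use assms c V_pos in \<open>intro summable_exp_neg_powr; simp\<close>)
qed

end

section \<open>The rates of the individual variables\<close>

locale visiting_process = scaling_pair a v A V + prob_space M
  for a v :: "real \<Rightarrow> real" and A V :: real and M :: "'s measure" +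
  fixes W :: "nat \<Rightarrow> 's \<Rightarrow> real" and J :: "real \<Rightarrow> ereal" and q F K :: real
  assumes W_measurable [measurable]: "\<And>n. W n \<in> borel_measurable M"
    and W_0: "AE \<omega> in M. W 0 \<omega> = 0"
    and J_nonneg: "\<And>x. 0 \<le> x \<Longrightarrow> 0 \<le> J x"
    and restricted: "restricted_LDP M W a v J"
    and J_0: "0 < J 0"
    and J_finite: "\<exists>y>0. J y < \<infinity>"
    and q_pos: "0 < q" and F_gt: "V / A < F" and K_pos: "0 < K"
    and decay: "uniform_individual_decay M W a v q F K"
begin

abbreviation tail :: "nat \<Rightarrow> real \<Rightarrow> real" where
  "tail n x \<equiv> prob {\<omega> \<in> space M. W n \<omega> > x}"

lemma tail_antimono: "x \<le> y \<Longrightarrow> tail n y \<le> tail n x"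
  by (rule finite_measure_mono) auto

lemma tail_scaled:
  assumes "n > 0"
  shows "prob {\<omega> \<in> space M. W n \<omega> / a n > c} = tail n (c * a n)"
  using a_pos[of n] assms by (simp add: less_divide_eq)

text \<open>The restricted large deviation principle with the scaling moved to the threshold, which is the form
  in which thresholds for different \<open>n\<close> can be compared.\<close>

lemma tail_rate_tendsto:
  assumes "c \<ge> 0"
  shows "(\<lambda>n. ereal (1 / v n) * log_prob (tail n (c * a n))) \<longlonglongrightarrow> - J c"
proof (rule Lim_transform_eventually)
  show "(\<lambda>n. ereal (1 / v n) * log_prob (prob {\<omega> \<in> space M. W n \<omega> / a n > c})) \<longlonglongrightarrow> - J c"
    using restricted assms by (simp add: restricted_LDP_def)
  show "\<forall>\<^sub>F n in sequentially. ereal (1 / v n) * log_prob (prob {\<omega> \<in> space M. W n \<omega> / a n > c})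
     = ereal (1 / v n) * log_prob (tail n (c * a n))"
    using eventually_gt_at_top[of 0] by eventually_elim (simp only: tail_scaled)
qed

lemma tail_upper:
  assumes "c \<ge> 0" "ereal \<theta> < J c"
  shows "\<forall>\<^sub>F n in sequentially. tail n (c * a n) \<le> exp (- (\<theta> * v n))"
proof -
  have "- J c < ereal (- \<theta>)" using assms by (cases "J c") auto
  from order_tendstoD(2)[OF tail_rate_tendsto[OF assms(1)] this] eventually_gt_at_top[of 0]
  show ?thesis
    by eventually_elim (rule log_rate_le_iff[THEN iffD1, OF v_pos less_imp_le]; simp)
qed

lemma tail_lower:
  assumes "c \<ge> 0" "J c < ereal \<theta>"
  shows "\<forall>\<^sub>F n in sequentially. exp (- (\<theta> * v n)) \<le> tail n (c * a n)"
proof -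
  have "ereal (- \<theta>) < - J c" using assms by (cases "J c") auto
  from order_tendstoD(1)[OF tail_rate_tendsto[OF assms(1)] this] eventually_gt_at_top[of 0]
  show ?thesis
    by eventually_elim (rule log_rate_ge_iff[THEN iffD1, OF v_pos less_imp_le]; simp)
qed

lemma tail_decay:
  assumes "n > 0" "c > K"
  shows "tail n (c * q * a n) \<le> exp (- (c powr F * v n))"
proof -
  have "a n \<noteq> 0" "v n \<noteq> 0" using a_pos[of n] v_pos[of n] assms by auto
  then have "ereal (1 / v n) * log_prob (prob {\<omega> \<in> space M. W n \<omega> / a n > c * q}) \<le> ereal (- (c powr F))"
    using decay assms unfolding uniform_individual_decay_def by auto
  then have "ereal (1 / v n) * log_prob (tail n (c * q * a n)) \<le> ereal (- (c powr F))"
    by (simp only: tail_scaled[OF assms(1)])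
  then show ?thesis using log_rate_le_iff v_pos[of n] assms(1) by simp
qed

lemma J_mono:
  assumes "0 \<le> x" "x \<le> y"
  shows "J x \<le> J y"
proof -
  have "- J y \<le> - J x"
  proof (rule LIMSEQ_le[OF tail_rate_tendsto tail_rate_tendsto])
    show "\<exists>N. \<forall>n\<ge>N. ereal (1 / v n) * log_prob (tail n (y * a n))
        \<le> ereal (1 / v n) * log_prob (tail n (x * a n))"
      using assms a_nonneg v_nonneg
      by (intro exI allI impI ereal_mult_left_mono log_prob_mono tail_antimono mult_right_mono) auto
  qed (use assms in auto)
  then show ?thesis by simp
qed

lemma J_superpower:
  assumes "c > K"
  shows "ereal (c powr F) \<le> J (c * q)"
proof -
  have "- J (c * q) \<le> ereal (- (c powr F))"
  proof (rule LIMSEQ_le_const2[OF tail_rate_tendsto])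
    show "\<exists>N. \<forall>n\<ge>N. ereal (1 / v n) * log_prob (tail n (c * q * a n)) \<le> ereal (- (c powr F))"
      using tail_decay[OF _ assms] log_rate_le_iff v_pos by (intro exI[of _ 1] allI impI) simp
  qed (use assms K_pos q_pos in auto)
  then show ?thesis by (cases "J (c * q)") auto
qed

text \<open>On \<open>c \<le> R\<close> monotonicity gives \<open>J c \<ge> J 0 > 0\<close> while \<open>c powr (V / A)\<close> is bounded; beyond
  \<open>R\<close> the bound \<open>J c \<ge> (c / q) powr F\<close> applies and \<open>F\<close> exceeds \<open>V / A\<close>. This is what makes
  the rate constant positive.\<close>

lemma J_power_lower_bound: "\<exists>r>0. \<forall>c>0. ereal (r * c powr (V / A)) \<le> J c"
proof -
  have p: "V / A > 0" using A_pos V_pos by simp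
  obtain j0 where j0: "0 < ereal j0" "ereal j0 < J 0"
    using J_0 ereal_dense2[of 0 "J 0"] by auto
  define R where "R = (K + 1) * q"
  have "R > 0" using K_pos q_pos by (simp add: R_def)
  define r1 where "r1 = j0 * R powr (- (V / A))"
  define r2 where "r2 = q powr (- F) * R powr (F - V / A)"
  have "r1 > 0" "r2 > 0" using j0 \<open>R > 0\<close> q_pos by (auto simp: r1_def r2_def)
  have "ereal (min r1 r2 * c powr (V / A)) \<le> J c" if c: "c > 0" for c
  proof (cases "c \<le> R")
    case True
    have "min r1 r2 * c powr (V / A) \<le> r1 * R powr (V / A)"
      using True c p \<open>r1 > 0\<close> \<open>r2 > 0\<close> by (intro mult_mono powr_mono2) auto
    also have "\<dots> = j0" using \<open>R > 0\<close> by (simp add: r1_def powr_minus)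
    finally have "ereal (min r1 r2 * c powr (V / A)) \<le> ereal j0" by simp
    also have "\<dots> \<le> J 0" using j0 by simp
    also have "\<dots> \<le> J c" using c by (intro J_mono) auto
    finally show ?thesis .
  next
    case False
    have "min r1 r2 * c powr (V / A) \<le> r2 * c powr (V / A)" by (intro mult_right_mono) auto
    also have "\<dots> \<le> q powr (- F) * c powr (F - V / A) * c powr (V / A)"
      unfolding r2_def using False \<open>R > 0\<close> F_gt by (intro mult_right_mono mult_left_mono powr_mono2) auto
    also have "\<dots> = q powr (- F) * c powr F"
      by (simp only: mult.assoc powr_add[symmetric]) simp
    also have "\<dots> = (c / q) powr F"
      using c q_pos by (simp add: powr_divide powr_minus field_simps)
    finally have "ereal (min r1 r2 * c powr (V / A)) \<le> ereal ((c / q) powr F)" by simp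
    also have "c / q > K + 1" using False q_pos by (simp add: R_def field_simps)
    then have "ereal ((c / q) powr F) \<le> J (c / q * q)" by (intro J_superpower) auto
    finally show ?thesis using q_pos by simp
  qed
  then show ?thesis using \<open>r1 > 0\<close> \<open>r2 > 0\<close> by (intro exI[of _ "min r1 r2"]) auto
qed

definition \<kappa> :: real where "\<kappa> = real_of_ereal (rate_const A V J)"

lemma rate_const_eq: "rate_const A V J = ereal \<kappa>" and \<kappa>_pos: "\<kappa> > 0"
proof -
  obtain r where r: "r > 0" "\<And>c. c > 0 \<Longrightarrow> ereal (r * c powr (V / A)) \<le> J c"
    using J_power_lower_bound by blast
  have "ereal r \<le> rate_const A V J"
    unfolding rate_const_def
  proof (rule INF_greatest)
    fix c :: real assume c: "c \<in> {0<..}"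
    have "ereal r = ereal (c powr (- (V / A))) * ereal (r * c powr (V / A))"
      using c by (simp add: powr_minus)
    also have "\<dots> \<le> ereal (c powr (- (V / A))) * J c"
      using r c by (intro ereal_mult_left_mono) auto
    finally show "ereal r \<le> ereal (c powr (- (V / A))) * J c" .
  qed
  moreover obtain y where y: "y > 0" "J y < \<infinity>" using J_finite by blast
  have "rate_const A V J \<le> ereal (y powr (- (V / A))) * J y"
    unfolding rate_const_def using y by (intro INF_lower) auto
  moreover have "\<dots> < \<infinity>" using y J_nonneg[of y] by (cases "J y") auto
  ultimately obtain k where "rate_const A V J = ereal k" "r \<le> k"
    by (cases "rate_const A V J") auto
  then show "rate_const A V J = ereal \<kappa>" "\<kappa> > 0" using r by (auto simp: \<kappa>_def)
qed

lemma J_ge_rate_const: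
  assumes "c > 0"
  shows "ereal (\<kappa> * c powr (V / A)) \<le> J c"
proof -
  have "ereal \<kappa> \<le> ereal (c powr (- (V / A))) * J c"
    unfolding rate_const_eq[symmetric] rate_const_def using assms by (intro INF_lower) auto
  moreover have "0 < c powr (V / A)" using assms by simp
  ultimately show ?thesis
    by (cases "J c") (simp_all add: powr_minus pos_le_divide_eq divide_inverse[symmetric] mult.commute
        split: if_splits)
qed

text \<open>The infimum that defines \<open>\<kappa>\<close> need not be attained, for instance if \<open>J\<close> jumps to \<open>\<infinity>\<close>; the lower
  bound below works with approximate minimisers instead.\<close>

lemma near_minimiser:
  assumes "l > \<kappa>"
  obtains c where "c > 0" "J c < ereal (l * c powr (V / A))"
proof -
  have "(INF c\<in>{0<..}. ereal (c powr (- (V / A))) * J c) < ereal l"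
    using assms rate_const_eq by (simp add: rate_const_def)
  then obtain c where c: "c > 0" "ereal (c powr (- (V / A))) * J c < ereal l"
    by (auto simp: INF_less_iff)
  moreover have "0 < c powr (V / A)" using c by simp
  ultimately have "J c < ereal (l * c powr (V / A))" using J_nonneg[of c]
    by (cases "J c") (simp_all add: powr_minus pos_divide_less_eq divide_inverse[symmetric] mult.commute
        split: if_splits)
  with c that show ?thesis by blast
qed

section \<open>Upper bound for exceeding a level\<close>

text \<open>For \<open>n\<close> close to \<open>s * t\<close> one has \<open>a t \<approx> s powr (- A) * a n\<close> and \<open>v n \<approx> s powr V * v t\<close>. With
  \<open>c\<close> slightly below \<open>s powr (- A)\<close> the cost is therefore about
  \<open>J c * s powr V \<ge> \<kappa> * c powr (V / A) * s powr V \<approx> \<kappa>\<close> times \<open>v t\<close>. All approximations are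
  paid for by powers of a single factor \<open>\<eta> < 1\<close>, chosen such that together they turn
  \<open>\<kappa>\<close> into exactly \<open>\<theta>\<close>.\<close>

lemma middle_terms_local:
  assumes s: "s > 0" and \<theta>: "0 < \<theta>" "\<theta> < \<kappa>"
  obtains s\<^sub>1 s\<^sub>2 where "0 < s\<^sub>1" "s\<^sub>1 < s" "s < s\<^sub>2"
    "\<forall>\<^sub>F t in at_top. \<forall>n. s\<^sub>1 * t < real n \<and> real n < s\<^sub>2 * t \<longrightarrow> tail n (a t) \<le> exp (- (\<theta> * v t))"
proof -
  define p where "p = V / A"
  have p: "p > 0" "A * p = V" using A_pos V_pos by (auto simp: p_def)
  define m where "m = 2 + p + 2 * V"
  have "m > 0" using p V_pos by (simp add: m_def)
  define \<eta> where "\<eta> = (\<theta> / \<kappa>) powr (1 / m)"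
  have ratio: "0 < \<theta> / \<kappa>" "\<theta> / \<kappa> < 1" using \<theta> by auto
  have \<eta>m: "\<eta> powr m = \<theta> / \<kappa>" 
    using \<open>m > 0\<close> \<theta>(1) \<kappa>_pos by (simp add: \<eta>_def powr_powr)
  have \<eta>: "0 < \<eta>" "\<eta> < 1"
    using powr_less_mono2[of "1 / m" "\<theta> / \<kappa>" 1] ratio \<open>m > 0\<close> by (auto simp: \<eta>_def)
  define s\<^sub>1 where "s\<^sub>1 = \<eta> * s"
  define s\<^sub>2 where "s\<^sub>2 = s / \<eta>"
  have s12: "0 < s\<^sub>1" "s\<^sub>1 < s" "s < s\<^sub>2" using s \<eta> by (auto simp: s\<^sub>1_def s\<^sub>2_def field_simps)
  define c where "c = \<eta> * s\<^sub>2 powr (- A)"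
  define \<beta> where "\<beta> = \<eta> * (\<kappa> * c powr p)"
  define \<gamma> where "\<gamma> = \<eta> * s\<^sub>1 powr V"
  have pos: "c > 0" "\<beta> > 0" "\<gamma> > 0" using s12 \<eta> \<kappa>_pos by (auto simp: c_def \<beta>_def \<gamma>_def)
  have "c powr p = \<eta> powr p * s\<^sub>2 powr (- V)"
    using \<eta> p by (simp add: c_def powr_mult powr_powr)
  also have "s\<^sub>2 powr (- V) = \<eta> powr V / s powr V"
    using s \<eta> by (simp add: s\<^sub>2_def powr_divide powr_minus field_simps)
  finally have "\<beta> * \<gamma> = \<kappa> * (\<eta> * \<eta> * \<eta> powr p * \<eta> powr V * \<eta> powr V)"
    using s \<eta> by (simp add: \<beta>_def \<gamma>_def s\<^sub>1_def powr_mult)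
  also have "\<dots> = \<kappa> * (\<eta> powr 1 * \<eta> powr 1 * \<eta> powr p * \<eta> powr V * \<eta> powr V)" using \<eta> by simp
  also have "\<dots> = \<kappa> * \<eta> powr m" by (simp only: powr_add[symmetric] m_def) (simp add: algebra_simps)
  also have "\<dots> = \<theta>" using \<eta>m \<kappa>_pos by simp
  finally have \<beta>\<gamma>: "\<beta> * \<gamma> = \<theta>" .
  have "\<beta> < \<kappa> * c powr p" using \<eta> \<kappa>_pos pos(1) by (simp add: \<beta>_def)
  then have "ereal \<beta> < J c" using J_ge_rate_const[OF pos(1)]
    by (metis ereal_less_eq(3) less_ereal.simps(1) order_less_le_trans p_def)
  from tail_upper[OF _ this] pos obtain N
    where N: "\<And>n. n \<ge> N \<Longrightarrow> tail n (c * a n) \<le> exp (- (\<beta> * v n))"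
    by (auto simp: eventually_sequentially)
  have "\<gamma> < s\<^sub>1 powr V" using \<eta> s12 by (simp add: \<gamma>_def)
  then have ev1: "\<forall>\<^sub>F t in at_top. \<gamma> < v (s\<^sub>1 * t) / v t"
    using v_rv s12 unfolding regularly_varying_def by (intro order_tendstoD(1)) auto
  have "s\<^sub>2 powr A < 1 / c" using \<eta> s12 by (simp add: c_def powr_minus field_simps)
  then have ev2: "\<forall>\<^sub>F t in at_top. a (s\<^sub>2 * t) / a t < 1 / c"
    using a_rv s12 unfolding regularly_varying_def by (intro order_tendstoD(2)) auto
  have "\<forall>\<^sub>F t in at_top. \<forall>n. s\<^sub>1 * t < real n \<and> real n < s\<^sub>2 * t \<longrightarrow> tail n (a t) \<le> exp (- (\<theta> * v t))"
    using ev1 ev2 eventually_gt_at_top[of 0] eventually_ge_at_top[of "real N / s\<^sub>1"]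
  proof eventually_elim
    case (elim t)
    show ?case
    proof (intro allI impI)
      fix n assume n: "s\<^sub>1 * t < real n \<and> real n < s\<^sub>2 * t"
      have "real N \<le> s\<^sub>1 * t" using elim s12 by (simp add: field_simps)
      then have "n \<ge> N" using n by linarith
      have "c * a n \<le> c * a (s\<^sub>2 * t)" using n pos by (intro mult_left_mono a_mono) auto
      also have "\<dots> \<le> a t" using elim pos a_pos[of t] by (simp add: field_simps)
      finally have "tail n (a t) \<le> tail n (c * a n)" by (rule tail_antimono)
      also have "\<dots> \<le> exp (- (\<beta> * v n))" using N \<open>n \<ge> N\<close> by simp
      also have "\<dots> \<le> exp (- (\<theta> * v t))"
      proof -
        have "\<gamma> * v t \<le> v (s\<^sub>1 * t)" using elim v_pos[of t] by (simp add: field_simps)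
        also have "\<dots> \<le> v n" using n elim s12 by (intro v_mono) auto
        finally have "\<beta> * (\<gamma> * v t) \<le> \<beta> * v n" using pos by (intro mult_left_mono) auto
        then show ?thesis by (simp add: \<beta>\<gamma>[symmetric] mult.assoc)
      qed
      finally show "tail n (a t) \<le> exp (- (\<theta> * v t))" .
    qed
  qed
  with s12 that show ?thesis by blast
qed

text \<open>The local bounds hold on neighbourhoods of the values of \<open>n / t\<close>; finitely many of these cover
  the compact interval.\<close>

lemma middle_terms:
  assumes "\<delta> > 0" and \<theta>: "0 < \<theta>" "\<theta> < \<kappa>"
  shows "\<forall>\<^sub>F t in at_top. \<forall>n. \<delta> * t \<le> real n \<and> real n \<le> R * t \<longrightarrow> tail n (a t) \<le> exp (- (\<theta> * v t))"
proof -
  let ?P = "\<lambda>t n. tail n (a t) \<le> exp (- (\<theta> * v t))"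
  \<comment> \<open>The predicate is named to keep the choice of the neighbourhoods below purely propositional.\<close>
  define good where "good s\<^sub>1 s\<^sub>2 \<longleftrightarrow>
      (\<forall>\<^sub>F t in at_top. \<forall>n. s\<^sub>1 * t < real n \<and> real n < s\<^sub>2 * t \<longrightarrow> ?P t n)" for s\<^sub>1 s\<^sub>2
  have "\<exists>s\<^sub>1 s\<^sub>2. s\<^sub>1 < s \<and> s < s\<^sub>2 \<and> good s\<^sub>1 s\<^sub>2"
    if "s \<in> {\<delta>..R}" for s
  proof -
    have "s > 0" using that \<open>\<delta> > 0\<close> by simp
    from middle_terms_local[OF this \<theta>] show ?thesis unfolding good_def by blast
  qed
  then obtain lo hi where lohi: "\<And>s. s \<in> {\<delta>..R} \<Longrightarrow> lo s < s \<and> s < hi s \<and> good (lo s) (hi s)"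
    by metis
  have "{\<delta>..R} \<subseteq> (\<Union>s\<in>{\<delta>..R}. {lo s<..<hi s})" using lohi by force
  then obtain C where C: "C \<subseteq> {\<delta>..R}" "finite C" "{\<delta>..R} \<subseteq> (\<Union>s\<in>C. {lo s<..<hi s})"
    using compactE_image[OF compact_Icc, of "{\<delta>..R}" "\<lambda>s. {lo s<..<hi s}"] by (metis open_greaterThanLessThan)
  have "\<forall>\<^sub>F t in at_top. \<forall>s\<in>C. \<forall>n. lo s * t < real n \<and> real n < hi s * t \<longrightarrow> ?P t n"
    using C(1,2) lohi by (intro eventually_ball_finite) (auto simp: good_def)
  then show ?thesis using eventually_gt_at_top[of 0]
  proof eventually_elim
    case (elim t)
    show ?case
    proof (intro allI impI)
      fix n assume "\<delta> * t \<le> real n \<and> real n \<le> R * t"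
      then have "real n / t \<in> {\<delta>..R}" using elim by (simp add: field_simps)
      then obtain s where "s \<in> C" "lo s < real n / t" "real n / t < hi s" using C(3) by fastforce
      then show "?P t n" using elim by (simp add: field_simps)
    qed
  qed
qed

text \<open>Uniform decay bounds the \<open>n\<close>-th tail by \<open>exp (- c powr F * v n)\<close> with \<open>c = a t / (a n * q)\<close>.
  This beats \<open>exp (- \<theta> * v t)\<close> when \<open>v n / a n powr F\<close> exceeds a large multiple of
  \<open>v t / a t powr F\<close>, which is the gap lemma for the indices \<open>V < A * F\<close>. A second use of the gap
  lemma, with a constant numerator, yields the condition \<open>c > K\<close>.\<close>

lemma small_terms:
  assumes \<theta>: "0 < \<theta>"
  obtains \<delta> where "\<delta> > 0"
    "\<forall>\<^sub>F t in at_top. \<forall>n>0. real n \<le> \<delta> * t \<longrightarrow> tail n (a t) \<le> exp (- (\<theta> * v t))"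
proof -
  have F: "F > 0" "V < A * F"
    using F_gt A_pos less_trans[OF divide_pos_pos[OF V_pos A_pos] F_gt] by (auto simp: field_simps)
  have "mono_on {0<..} (\<lambda>t. a t powr F)"
    by (rule mono_onI) (use F(1) a_pos a_mono in \<open>simp add: powr_mono2 less_imp_le\<close>)
  moreover have "0 < a t powr F" if "t > 0" for t using a_pos[OF that] by simp
  ultimately have "\<exists>\<delta>>0. \<exists>T. \<forall>s\<ge>1. \<forall>t\<ge>T. s \<le> \<delta> * t \<longrightarrow>
      \<theta> * q powr F * (v t / a t powr F) \<le> v s / a s powr F"
    by (intro regularly_varying_quotient_gap[OF v_mono_on_pos v_pos v_rv _ _ regularly_varying_powr[OF a_rv a_pos] F(2)])
      (use \<theta> q_pos in auto)
  then obtain \<delta>\<^sub>1 T\<^sub>1 where 1: "\<delta>\<^sub>1 > 0" "\<And>s t. s \<ge> 1 \<Longrightarrow> t \<ge> T\<^sub>1 \<Longrightarrow> s \<le> \<delta>\<^sub>1 * t \<Longrightarrow>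
      \<theta> * q powr F * (v t / a t powr F) \<le> v s / a s powr F"
    by blast
  have "\<exists>\<delta>>0. \<exists>T. \<forall>s\<ge>1. \<forall>t\<ge>T. s \<le> \<delta> * t \<longrightarrow> 2 * K * q * (1 / a t) \<le> 1 / a s"
    by (rule regularly_varying_quotient_gap[OF _ _ regularly_varying_const a_mono_on_pos a_pos a_rv A_pos])
      (use K_pos q_pos in \<open>auto simp: mono_on_def\<close>)
  then obtain \<delta>\<^sub>2 T\<^sub>2 where 2: "\<delta>\<^sub>2 > 0" "\<And>s t. s \<ge> 1 \<Longrightarrow> t \<ge> T\<^sub>2 \<Longrightarrow> s \<le> \<delta>\<^sub>2 * t \<Longrightarrow>
      2 * K * q * (1 / a t) \<le> 1 / a s"
    by blast
  define \<delta> where "\<delta> = min \<delta>\<^sub>1 \<delta>\<^sub>2"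
  have "\<delta> > 0" using 1 2 by (simp add: \<delta>_def)
  moreover have "\<forall>\<^sub>F t in at_top. \<forall>n>0. real n \<le> \<delta> * t \<longrightarrow> tail n (a t) \<le> exp (- (\<theta> * v t))"
    using eventually_ge_at_top[of T\<^sub>1] eventually_ge_at_top[of T\<^sub>2] eventually_gt_at_top[of 0]
  proof eventually_elim
    case (elim t)
    show ?case
    proof (intro allI impI)
      fix n :: nat assume n: "n > 0" "real n \<le> \<delta> * t"
      have "\<delta> * t \<le> \<delta>\<^sub>1 * t" "\<delta> * t \<le> \<delta>\<^sub>2 * t"
        using elim by (auto intro!: mult_right_mono simp: \<delta>_def)
      then have "real n \<le> \<delta>\<^sub>1 * t" "real n \<le> \<delta>\<^sub>2 * t" using n by linarith+
      then have *: "\<theta> * q powr F * (v t / a t powr F) \<le> v n / a n powr F"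
        "2 * K * q * (1 / a t) \<le> 1 / a n"
        using 1(2)[of "real n" t] 2(2)[of "real n" t] n elim by auto
      have pos: "a n > 0" "a t > 0" "v t > 0" "v n > 0" using a_pos v_pos n elim by auto
      define c where "c = a t / (a n * q)"
      have "2 * K \<le> c" using *(2) pos q_pos by (simp add: c_def field_simps)
      then have "K < c" using K_pos by linarith
      from tail_decay[OF n(1) this] have "tail n (a t) \<le> exp (- (c powr F * v n))"
        using pos q_pos by (simp add: c_def)
      also have "\<theta> * v t \<le> c powr F * v n"
        using *(1) pos q_pos by (simp add: c_def powr_divide powr_mult field_simps)
      then have "exp (- (c powr F * v n)) \<le> exp (- (\<theta> * v t))" by simp
      finally show "tail n (a t) \<le> exp (- (\<theta> * v t))" .
    qed
  qed
  ultimately show ?thesis using that by blast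
qed

text \<open>Late exceedances are bounded by \<open>P(W n > 0) \<le> exp (- j * v n)\<close> with \<open>0 < j < J 0\<close>. Half of this
  exponent supplies the factor \<open>exp (- \<theta> * v t)\<close> if \<open>R\<close> is large, the other half the summable
  sequence \<open>b\<close>.\<close>

lemma large_terms:
  assumes \<theta>: "0 < \<theta>"
  obtains R b where "summable b" "\<And>n::nat. 0 \<le> b n"
    "\<forall>\<^sub>F t in at_top. \<forall>n. R * t < real n \<longrightarrow> tail n (a t) \<le> exp (- (\<theta> * v t)) * b n"
proof -
  obtain j where j: "0 < ereal j" "ereal j < J 0"
    using J_0 ereal_dense2[of 0 "J 0"] by auto
  then have "j > 0" by simp
  from tail_upper[OF _ j(2)] obtain N
    where N: "\<And>n. n \<ge> N \<Longrightarrow> tail n 0 \<le> exp (- (j * v n))"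
    by (auto simp: eventually_sequentially)
  \<comment> \<open>Then \<open>v (R * t) / v t\<close> tends to \<open>R powr V\<close>, which exceeds \<open>2 * \<theta> / j\<close>.\<close>
  define R where "R = (2 * \<theta> / j + 1) powr (1 / V)"
  have "2 * \<theta> / j > 0" using \<theta> \<open>j > 0\<close> by simp
  then have R: "R > 0" "R powr V = 2 * \<theta> / j + 1"
    using V_pos unfolding R_def by (simp_all add: powr_powr add_pos_pos)
  then have ev: "\<forall>\<^sub>F t in at_top. 2 * \<theta> / j < v (R * t) / v t"
    using v_rv R unfolding regularly_varying_def by (intro order_tendstoD(1)) auto
  define b where "b = (\<lambda>n. exp (- (j / 2 * v (real n))))"
  have "\<forall>\<^sub>F t in at_top. \<forall>n. R * t < real n \<longrightarrow> tail n (a t) \<le> exp (- (\<theta> * v t)) * b n"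
    using ev eventually_gt_at_top[of 0] eventually_ge_at_top[of "real N / R"]
  proof eventually_elim
    case (elim t)
    show ?case
    proof (intro allI impI)
      fix n assume n: "R * t < real n"
      have "real N \<le> R * t" using elim R by (simp add: field_simps)
      then have "n \<ge> N" using n by linarith
      have "2 * \<theta> / j * v t \<le> v (R * t)" using elim v_pos[of t] by (simp add: field_simps)
      also have "\<dots> \<le> v n" using n elim R by (intro v_mono) auto
      finally have le: "\<theta> * v t \<le> j / 2 * v n" using \<open>j > 0\<close> by (simp add: field_simps)
      have "tail n (a t) \<le> tail n 0" using a_nonneg elim by (intro tail_antimono) auto
      also have "\<dots> \<le> exp (- (j * v n))" using N \<open>n \<ge> N\<close> by simp
      also have "\<dots> = exp (- (j / 2 * v n)) * b n"
        by (simp add: b_def exp_add[symmetric])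
      also have "\<dots> \<le> exp (- (\<theta> * v t)) * b n" using le by (intro mult_right_mono) (auto simp: b_def)
      finally show "tail n (a t) \<le> exp (- (\<theta> * v t)) * b n" .
    qed
  qed
  moreover have "summable b" unfolding b_def using \<open>j > 0\<close> by (intro summable_exp_neg_v) auto
  ultimately show ?thesis using that[of b R] by (auto simp: b_def)
qed

abbreviation hit :: "real \<Rightarrow> real" where
  "hit u \<equiv> prob {\<omega> \<in> space M. \<exists>n. W n \<omega> > u}"

lemma hit_le_suminf:
  assumes "\<And>n. tail n u \<le> b n" "summable b"
  shows "hit u \<le> (\<Sum>n. b n)"
proof -
  have sm: "summable (\<lambda>n. tail n u)"
    by (rule summable_comparison_test'[OF assms(2), of 0]) (use assms(1) in auto)
  have "{\<omega> \<in> space M. \<exists>n. W n \<omega> > u} = (\<Union>n. {\<omega> \<in> space M. W n \<omega> > u})" by auto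
  moreover have "prob (\<Union>n. {\<omega> \<in> space M. W n \<omega> > u}) \<le> (\<Sum>n. tail n u)"
    using sm by (intro finite_measure_subadditive_countably) auto
  ultimately have "hit u \<le> (\<Sum>n. tail n u)" by simp
  also have "\<dots> \<le> (\<Sum>n. b n)" using assms sm by (intro suminf_le)
  finally show ?thesis .
qed

lemma tail_0: "u \<ge> 0 \<Longrightarrow> tail 0 u = 0"
  using W_0 by (subst prob_eq_0) (auto elim!: AE_mp)

text \<open>Union bound: at most \<open>R * t + 1\<close> times contribute \<open>exp (- \<theta>' * v t)\<close> each and the later ones
  together a constant multiple of it. Because \<open>v t\<close> grows faster than a power of \<open>t\<close>, the linearly growing number
  of terms is absorbed by lowering \<open>\<theta>'\<close> to \<open>\<theta>\<close>. Time \<open>0\<close>, where the scaling may degenerate,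
  contributes nothing because \<open>W 0 = 0\<close>.\<close>

lemma hit_upper_time:
  assumes \<theta>: "0 < \<theta>" "\<theta> < \<kappa>"
  shows "\<forall>\<^sub>F t in at_top. hit (a t) \<le> exp (- (\<theta> * v t))"
proof -
  define \<theta>' where "\<theta>' = (\<theta> + \<kappa>) / 2"
  have \<theta>': "0 < \<theta>'" "\<theta> < \<theta>'" "\<theta>' < \<kappa>" using \<theta> by (auto simp: \<theta>'_def)
  obtain \<delta> where \<delta>: "\<delta> > 0" and
    small: "\<forall>\<^sub>F t in at_top. \<forall>n>0. real n \<le> \<delta> * t \<longrightarrow> tail n (a t) \<le> exp (- (\<theta>' * v t))"
    by (rule small_terms[OF \<theta>'(1)])
  obtain b R where b: "summable b" "\<And>n::nat. 0 \<le> b n" and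
    large: "\<forall>\<^sub>F t in at_top. \<forall>n. R * t < real n \<longrightarrow> tail n (a t) \<le> exp (- (\<theta>' * v t)) * b n"
    by (rule large_terms[OF \<theta>'(1)]) (rule that; assumption)
  note middle = middle_terms[OF \<delta> \<theta>'(1,3), of R]
  obtain c where c: "c > 0" and power: "\<forall>\<^sub>F t in at_top. c * t powr (V / 2) \<le> v t"
    using powr_eventually_below[OF v_mono_on_pos v_pos v_rv V_pos] by blast
  define B where "B = (\<Sum>n. b n)"
  have growth: "\<forall>\<^sub>F t in at_top. \<bar>R\<bar> * t + (1 + B) \<le> exp ((\<theta>' - \<theta>) * c * t powr (V / 2))"
    using linear_le_exp_powr[of "(\<theta>' - \<theta>) * c" "V / 2"] c \<theta>' V_pos by simp
  show ?thesis
    using small middle large power growth eventually_gt_at_top[of 0]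
  proof eventually_elim
    case (elim t)
    define e where "e = exp (- (\<theta>' * v t))"
    define S where "S = {n::nat. real n \<le> R * t}"
    have "S \<subseteq> {..nat \<lfloor>\<bar>R\<bar> * t\<rfloor>}"
    proof
      fix n assume "n \<in> S"
      moreover have "R * t \<le> \<bar>R\<bar> * t" using elim by (intro mult_right_mono) auto
      ultimately have "real n \<le> \<bar>R\<bar> * t" by (simp add: S_def)
      then show "n \<in> {..nat \<lfloor>\<bar>R\<bar> * t\<rfloor>}" by (simp add: le_nat_floor)
    qed
    note finite_subset[OF this finite_atMost] card_mono[OF finite_atMost this]
    moreover have "real (nat \<lfloor>\<bar>R\<bar> * t\<rfloor>) \<le> \<bar>R\<bar> * t" using elim by (intro of_nat_floor) auto
    ultimately have S: "finite S" "real (card S) \<le> \<bar>R\<bar> * t + 1" by simp_all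
    have sums: "(\<lambda>n. (if n \<in> S then e else 0) + e * b n) sums (real (card S) * e + e * B)"
      using sums_If_finite_set[OF S(1), of "\<lambda>_. e"] summable_sums[OF b(1)]
      by (intro sums_add sums_mult) (auto simp: B_def)
    have "tail n (a t) \<le> (if n \<in> S then e else 0) + e * b n" for n
    proof (cases "n \<in> S")
      case True
      have "tail n (a t) \<le> e"
      proof (cases "n = 0")
        case True
        then show ?thesis using tail_0 a_nonneg elim by (simp add: e_def)
      next
        case False
        then show ?thesis using \<open>n \<in> S\<close> elim(1,2) by (cases "real n \<le> \<delta> * t") (auto simp: S_def e_def)
      qed
      then show ?thesis using True b(2)[of n] by (simp add: e_def add_increasing2)
    next
      case False
      then show ?thesis using elim(3) by (simp add: S_def e_def)
    qed
    then have "hit (a t) \<le> real (card S) * e + e * B"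
      unfolding sums_unique[OF sums] by (rule hit_le_suminf[OF _ sums_summable[OF sums]])
    also have "\<dots> = (real (card S) + B) * e" by (simp add: algebra_simps)
    also have "\<dots> \<le> (\<bar>R\<bar> * t + (1 + B)) * e" using S by (intro mult_right_mono) (auto simp: e_def)
    also have "\<dots> \<le> exp ((\<theta>' - \<theta>) * c * t powr (V / 2)) * e"
      using elim(5) by (rule mult_right_mono) (simp add: e_def)
    also have "\<dots> \<le> exp ((\<theta>' - \<theta>) * v t) * e"
      using elim(4) \<theta>' by (intro mult_right_mono) (auto simp: e_def mult.assoc)
    also have "\<dots> = exp (- (\<theta> * v t))" by (simp add: e_def exp_add[symmetric] algebra_simps)
    finally show ?case .
  qed
qed

lemma hit_upper:
  assumes x: "x > 0" and \<theta>: "\<theta> < \<kappa> * x powr (V / A)"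
  shows "\<forall>\<^sub>F u in at_top. hit (x * u) \<le> exp (- (\<theta> * h u))"
proof (cases "\<theta> > 0")
  case True
  define X where "X = x powr (V / A)"
  have X: "X > 0" using x by (simp add: X_def)
  have "\<theta> / X < \<kappa>" using \<theta> X by (simp add: X_def field_simps)
  then obtain \<theta>\<^sub>1 where *: "\<theta> / X < \<theta>\<^sub>1" "\<theta>\<^sub>1 < \<kappa>" using dense by blast
  then have \<theta>\<^sub>1: "0 < \<theta>\<^sub>1" "\<theta>\<^sub>1 < \<kappa>" "\<theta> / X < \<theta>\<^sub>1"
    using less_trans[OF divide_pos_pos[OF True X]] by auto
  have "filterlim (\<lambda>u. \<tau> (x * u)) at_top at_top"
    using filterlim_compose[OF tau_at_top filterlim_scale_at_top[OF x]] .
  from eventually_compose_filterlim[OF hit_upper_time[OF \<theta>\<^sub>1(1,2)] this]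
  have "\<forall>\<^sub>F u in at_top. hit (a (\<tau> (x * u))) \<le> exp (- (\<theta>\<^sub>1 * v (\<tau> (x * u))))" .
  moreover have "\<forall>\<^sub>F u in at_top. a (\<tau> (x * u)) = x * u"
    using eventually_compose_filterlim[OF tau_eventually filterlim_scale_at_top[OF x]]
    by eventually_elim simp
  moreover have "\<theta> / \<theta>\<^sub>1 < X" using \<theta>\<^sub>1 X by (simp add: field_simps)
  then have "\<forall>\<^sub>F u in at_top. \<theta> / \<theta>\<^sub>1 < h (x * u) / h u"
    using speed_ratio[OF x] by (intro order_tendstoD(1)) (auto simp: X_def)
  ultimately show ?thesis using speed_pos
  proof eventually_elim
    case (elim u)
    then have "\<theta> * h u \<le> \<theta>\<^sub>1 * h (x * u)" using \<theta>\<^sub>1 by (simp add: field_simps)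
    then have "exp (- (\<theta>\<^sub>1 * h (x * u))) \<le> exp (- (\<theta> * h u))" by simp
    moreover have "hit (x * u) \<le> exp (- (\<theta>\<^sub>1 * h (x * u)))" using elim by (simp add: speed_eq)
    ultimately show ?case by (rule order_trans[rotated])
  qed
next
  case False
  show ?thesis using speed_pos
  proof eventually_elim
    case (elim u)
    then have "- (\<theta> * h u) \<ge> 0" using False by (simp add: mult_nonpos_nonneg)
    then have "1 \<le> exp (- (\<theta> * h u))" by simp
    then show ?case using prob_le_1 order_trans by blast
  qed
qed

section \<open>Lower bound for visiting a window\<close>

text \<open>With \<open>1 < d < 1 + \<epsilon>\<close>, the interval from \<open>c * a n\<close> to \<open>d * c * a n\<close> fits into the window as soon
  as \<open>c * a n \<approx> u\<close>. The approximate minimiser \<open>c\<close> is taken so good that \<open>J c < l * c powr p\<close> with \<open>l < \<kappa> * d powr p\<close>; then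
  \<open>J (d * c) \<ge> \<kappa> * (d * c) powr p > l * c powr p > J c\<close>, so the difference of the two tails at
  \<open>c * a n\<close> and \<open>d * c * a n\<close> has the rate of the first. The time \<open>n\<close> is \<open>\<tau> u * c powr (- 1 / A)\<close>
  rounded up, for which \<open>a n \<approx> u / c\<close> and \<open>v n \<approx> h u / c powr p\<close>.\<close>

lemma window_lower_unit:
  assumes \<theta>: "\<theta> > \<kappa>" and \<epsilon>: "\<epsilon> > 0"
  shows "\<forall>\<^sub>F u in at_top. exp (- (\<theta> * h u))
    \<le> prob {\<omega> \<in> space M. \<exists>n. (1 - \<epsilon>) * u < W n \<omega> \<and> W n \<omega> < (1 + \<epsilon>) * u}"
proof -
  define p where "p = V / A"
  have p: "p > 0" using A_pos V_pos by (simp add: p_def)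
  define d where "d = 1 + \<epsilon> / 2"
  have d: "d > 1" "d < 1 + \<epsilon>" using \<epsilon> by (auto simp: d_def)
  have "1 < d powr p" using powr_less_mono2[of p 1 d] p d by simp
  then have "\<kappa> < min \<theta> (\<kappa> * d powr p)" using \<theta> \<kappa>_pos by simp
  then obtain l where l: "\<kappa> < l" "l < min \<theta> (\<kappa> * d powr p)" using dense by blast
  obtain l' where l': "l < l'" "l' < \<theta>" using dense[of l \<theta>] l by auto
  obtain c where c: "c > 0" "J c < ereal (l * c powr p)"
    using near_minimiser[OF l(1)] unfolding p_def by blast
  define x where "x = c powr p"
  have x: "x > 0" using c by (simp add: x_def)
  have "l * x < \<kappa> * (d * c) powr p"
    using l(2) x d c mult_strict_right_mono[of l "\<kappa> * d powr p" x] by (simp add: powr_mult x_def mult.assoc)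
  then obtain \<beta> where \<beta>: "l * x < \<beta>" "\<beta> < \<kappa> * (d * c) powr p" using dense by blast
  have Jd: "ereal \<beta> < J (d * c)"
    using J_ge_rate_const[of "d * c"] \<beta> d c unfolding p_def
    by (metis ereal_less(2) less_ereal.simps(1) mult_pos_pos order_less_le_trans order_less_trans zero_less_one)
  \<comment> \<open>\<open>a (s * \<tau> u)\<close> is asymptotic to \<open>s powr A * u = u / c\<close>.\<close>
  define s where "s = c powr (- (1 / A))"
  have s: "s > 0" "s powr A = 1 / c" "s powr V = 1 / x"
    using c A_pos unfolding s_def x_def p_def powr_powr by (simp_all add: powr_minus_divide)
  define N where "N = (\<lambda>u. nat \<lceil>s * \<tau> u\<rceil>)"
  have Nge: "\<forall>\<^sub>F u in at_top. s * \<tau> u \<le> real (N u)"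
    by (auto simp: N_def intro: always_eventually real_nat_ceiling_ge)
  have "filterlim (\<lambda>u. s * \<tau> u) at_top at_top"
    using s by (intro filterlim_tendsto_pos_mult_at_top[OF tendsto_const] tau_at_top)
  then have "filterlim (\<lambda>u. real (N u)) at_top at_top" using Nge by (rule filterlim_at_top_mono)
  then have N: "filterlim N sequentially at_top" by (simp add: filterlim_sequentially_iff_filterlim_real)
  have Nratio: "((\<lambda>u. real (N u) / \<tau> u) \<longlongrightarrow> s) at_top"
  proof (rule tendsto_sandwich[where f = "\<lambda>_. s" and h = "\<lambda>u. s + 1 / \<tau> u"])
    have "((\<lambda>u. s + 1 / \<tau> u) \<longlongrightarrow> s + 0) at_top"
      by (intro tendsto_add tendsto_const real_tendsto_divide_at_top[OF tendsto_const tau_at_top])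
    then show "((\<lambda>u. s + 1 / \<tau> u) \<longlongrightarrow> s) at_top" by simp
    show "\<forall>\<^sub>F u in at_top. s \<le> real (N u) / \<tau> u"
      using Nge tau_eventually by eventually_elim (simp add: field_simps)
    show "\<forall>\<^sub>F u in at_top. real (N u) / \<tau> u \<le> s + 1 / \<tau> u"
      using tau_eventually
    proof eventually_elim
      case (elim u)
      then have "real (N u) \<le> s * \<tau> u + 1" using s by (simp add: N_def)
      then show ?case using elim by (simp add: field_simps)
    qed
  qed (rule tendsto_const)
  have "((\<lambda>u. a (real (N u)) / a (\<tau> u)) \<longlongrightarrow> s powr A) at_top"
    by (rule regularly_varying_ratio_limit[OF a_mono_on a_pos a_rv A_pos tau_at_top Nratio s(1)])
  then have aN: "((\<lambda>u. a (real (N u)) / a (\<tau> u)) \<longlongrightarrow> 1 / c) at_top" by (simp add: s)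
  have "((\<lambda>u. v (real (N u)) / v (\<tau> u)) \<longlongrightarrow> s powr V) at_top"
    by (rule regularly_varying_ratio_limit[OF v_mono_on v_pos v_rv V_pos tau_at_top Nratio s(1)])
  then have vN: "((\<lambda>u. v (real (N u)) / v (\<tau> u)) \<longlongrightarrow> 1 / x) at_top" by (simp add: s)
  have "(1 - \<epsilon>) / c < 1 / c" "1 / c < (1 + \<epsilon>) / (d * c)"
    using c d \<epsilon> by (auto simp: field_simps)
  then have a_ev: "\<forall>\<^sub>F u in at_top. (1 - \<epsilon>) / c < a (real (N u)) / a (\<tau> u)"
      "\<forall>\<^sub>F u in at_top. a (real (N u)) / a (\<tau> u) < (1 + \<epsilon>) / (d * c)"
    using order_tendstoD[OF aN] by auto
  have "0 < l'" using \<kappa>_pos l l' by simp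
  then have "1 / x < \<theta> / (l' * x)" using x l' by (simp add: field_simps)
  then have v_ev: "\<forall>\<^sub>F u in at_top. v (real (N u)) / v (\<tau> u) < \<theta> / (l' * x)"
    using order_tendstoD[OF vN] by auto
  have lower: "\<forall>\<^sub>F u in at_top. exp (- (l * x * v (N u))) \<le> tail (N u) (c * a (N u))"
    using eventually_compose_filterlim[OF tail_lower N] c unfolding x_def by simp
  have upper: "\<forall>\<^sub>F u in at_top. tail (N u) (d * c * a (N u)) \<le> exp (- (\<beta> * v (N u)))"
    using eventually_compose_filterlim[OF tail_upper[OF _ Jd] N] c d by simp
  have "l * x < l' * x" using l' x by simp
  have "filterlim (\<lambda>u. v (real (N u))) at_top at_top"
    by (intro filterlim_compose[OF v_at_top] filterlim_compose[OF filterlim_real_sequentially N])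
  from eventually_exp_le_diff[OF this \<beta>(1) \<open>l * x < l' * x\<close>]
  have "\<forall>\<^sub>F u in at_top. exp (- (l' * x * v (N u))) \<le> exp (- (l * x * v (N u))) - exp (- (\<beta> * v (N u)))" .
  then show ?thesis
    using a_ev v_ev lower upper tau_eventually
  proof eventually_elim
    case (elim u)
    let ?n = "N u"
    have u: "u > 0" "a (\<tau> u) = u" "h u = v (\<tau> u)" "v (\<tau> u) > 0"
      using elim a_pos[of "\<tau> u"] v_pos[of "\<tau> u"] by (auto simp: speed_eq)
    have "l' * x * v ?n \<le> \<theta> * h u"
      using elim(4) u x \<open>0 < l'\<close> by (simp add: field_simps)
    then have "exp (- (\<theta> * h u)) \<le> exp (- (l' * x * v ?n))" by simp
    also have "\<dots> \<le> tail ?n (c * a ?n) - tail ?n (d * c * a ?n)" using elim by linarith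
    also have "\<dots> = prob ({\<omega> \<in> space M. W ?n \<omega> > c * a ?n} - {\<omega> \<in> space M. W ?n \<omega> > d * c * a ?n})"
    proof (rule finite_measure_Diff[symmetric])
      have "1 * (c * a ?n) \<le> d * (c * a ?n)" using d c a_nonneg by (intro mult_right_mono) auto
      then show "{\<omega> \<in> space M. W ?n \<omega> > d * c * a ?n} \<subseteq> {\<omega> \<in> space M. W ?n \<omega> > c * a ?n}"
        by (auto simp: mult.assoc)
    qed auto
    also have "\<dots> \<le> prob {\<omega> \<in> space M. \<exists>n. (1 - \<epsilon>) * u < W n \<omega> \<and> W n \<omega> < (1 + \<epsilon>) * u}"
    proof (rule finite_measure_mono)
      have "(1 - \<epsilon>) * u < c * a ?n" "d * c * a ?n < (1 + \<epsilon>) * u"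
        using elim(2,3) u c d by (auto simp: field_simps)
      then show "{\<omega> \<in> space M. W ?n \<omega> > c * a ?n} - {\<omega> \<in> space M. W ?n \<omega> > d * c * a ?n}
        \<subseteq> {\<omega> \<in> space M. \<exists>n. (1 - \<epsilon>) * u < W n \<omega> \<and> W n \<omega> < (1 + \<epsilon>) * u}"
        by (auto intro!: exI[of _ ?n])
    qed measurable
    finally show ?case .
  qed
qed

text \<open>The previous bound at level \<open>x * u\<close>, transferred to the speed \<open>h u\<close> by the regular variation of
  \<open>h\<close>.\<close>

lemma window_lower:
  assumes yxz: "0 \<le> y" "y < x" "x < z" and \<theta>: "\<theta> > \<kappa> * x powr (V / A)"
  shows "\<forall>\<^sub>F u in at_top. exp (- (\<theta> * h u))
    \<le> prob {\<omega> \<in> space M. \<exists>n. y * u < W n \<omega> \<and> W n \<omega> < z * u}"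
proof -
  define X where "X = x powr (V / A)"
  have x: "x > 0" and X: "X > 0" using yxz by (auto simp: X_def)
  have "\<kappa> < \<theta> / X" using \<theta> X by (simp add: X_def field_simps)
  then obtain \<theta>\<^sub>1 where \<theta>\<^sub>1: "\<kappa> < \<theta>\<^sub>1" "\<theta>\<^sub>1 < \<theta> / X" using dense by blast
  have "\<theta>\<^sub>1 > 0" using \<theta>\<^sub>1 \<kappa>_pos by simp
  define \<epsilon> where "\<epsilon> = min ((x - y) / x) ((z - x) / x)"
  have \<epsilon>: "\<epsilon> > 0" "\<epsilon> \<le> (x - y) / x" "\<epsilon> \<le> (z - x) / x" using yxz x by (auto simp: \<epsilon>_def)
  have yz: "y \<le> (1 - \<epsilon>) * x" "(1 + \<epsilon>) * x \<le> z" using \<epsilon> x by (auto simp: field_simps)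
  have "X < \<theta> / \<theta>\<^sub>1" using \<theta>\<^sub>1 X \<open>\<theta>\<^sub>1 > 0\<close> by (simp add: field_simps)
  then have ev: "\<forall>\<^sub>F u in at_top. h (x * u) / h u < \<theta> / \<theta>\<^sub>1"
    using speed_ratio[OF x] by (intro order_tendstoD(2)) (auto simp: X_def)
  show ?thesis
    using eventually_compose_filterlim[OF window_lower_unit[OF \<theta>\<^sub>1(1) \<epsilon>(1)] filterlim_scale_at_top[OF x]]
      ev speed_pos eventually_gt_at_top[of 0]
  proof eventually_elim
    case (elim u)
    have "\<theta>\<^sub>1 * h (x * u) \<le> \<theta> * h u" using elim \<open>\<theta>\<^sub>1 > 0\<close> by (simp add: field_simps)
    then have "exp (- (\<theta> * h u)) \<le> exp (- (\<theta>\<^sub>1 * h (x * u)))" by simp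
    also note elim(1)
    also have "prob {\<omega> \<in> space M. \<exists>n. (1 - \<epsilon>) * (x * u) < W n \<omega> \<and> W n \<omega> < (1 + \<epsilon>) * (x * u)}
      \<le> prob {\<omega> \<in> space M. \<exists>n. y * u < W n \<omega> \<and> W n \<omega> < z * u}"
    proof (rule finite_measure_mono)
      have "y * u \<le> (1 - \<epsilon>) * (x * u)" "(1 + \<epsilon>) * (x * u) \<le> z * u"
        using yz elim(4) by (simp_all only: mult.assoc[symmetric] mult_le_cancel_right) auto
      then show "{\<omega> \<in> space M. \<exists>n. (1 - \<epsilon>) * (x * u) < W n \<omega> \<and> W n \<omega> < (1 + \<epsilon>) * (x * u)}
        \<subseteq> {\<omega> \<in> space M. \<exists>n. y * u < W n \<omega> \<and> W n \<omega> < z * u}"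
        by (auto intro: le_less_trans less_le_trans)
    qed measurable
    finally show ?case .
  qed
qed

section \<open>The law of the supremum\<close>

text \<open>Taking the supremum in the extended reals makes measurability immediate; on the null set where it
  is infinite the conversion yields the value \<open>0\<close>.\<close>

definition sup_W :: "'s \<Rightarrow> real" where
  "sup_W \<omega> = real_of_ereal (SUP n. ereal (W n \<omega>))"

lemma sup_W_measurable [measurable]: "sup_W \<in> borel_measurable M"
  unfolding sup_W_def by measurable

lemma hit_tendsto_0: "(hit \<longlongrightarrow> 0) at_top"
proof (rule tendsto_sandwich[OF _ _ tendsto_const])
  show "\<forall>\<^sub>F u in at_top. hit u \<le> exp (- (\<kappa> / 2 * h u))"
    using hit_upper[of 1 "\<kappa> / 2"] \<kappa>_pos by simp
  have "filterlim (\<lambda>u. - (\<kappa> / 2 * h u)) at_bot at_top"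
    using \<kappa>_pos by (intro filterlim_uminus_at_bot_at_top[THEN filterlim_compose]
      filterlim_tendsto_pos_mult_at_top[OF tendsto_const] speed_at_top) auto
  then show "((\<lambda>u. exp (- (\<kappa> / 2 * h u))) \<longlongrightarrow> 0) at_top"
    by (rule filterlim_compose[OF exp_at_bot])
qed auto

text \<open>An unbounded path exceeds every level, and the probability of exceeding a level tends to \<open>0\<close>.\<close>

lemma AE_bounded: "AE \<omega> in M. bdd_above (range (\<lambda>n. W n \<omega>))"
proof -
  let ?N = "{\<omega> \<in> space M. \<forall>k::nat. \<exists>n. W n \<omega> > real k}"
  have "prob ?N \<le> 0"
  proof (rule tendsto_lowerbound[OF filterlim_compose[OF hit_tendsto_0 filterlim_real_sequentially]])
    show "\<forall>\<^sub>F k in sequentially. prob ?N \<le> hit (real k)"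
      by (intro always_eventually allI finite_measure_mono) auto
  qed simp
  then have "prob ?N = 0" by (simp add: measure_le_0_iff)
  then have "AE \<omega> in M. \<not> (\<forall>k::nat. \<exists>n. W n \<omega> > real k)" by (subst (asm) prob_eq_0) auto
  then show ?thesis
    by eventually_elim (auto simp: not_less bdd_above_def)
qed

lemma sup_W_greater_iff:
  assumes "bdd_above (range (\<lambda>n. W n \<omega>))"
  shows "x < sup_W \<omega> \<longleftrightarrow> (\<exists>n. x < W n \<omega>)"
proof -
  obtain B where B: "\<And>n. W n \<omega> \<le> B" using assms by (auto simp: bdd_above_def)
  have "(SUP n. ereal (W n \<omega>)) \<le> ereal B" using B by (intro SUP_least) auto
  moreover have "ereal (W 0 \<omega>) \<le> (SUP n. ereal (W n \<omega>))" by (intro SUP_upper) auto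
  ultimately have "ereal (sup_W \<omega>) = (SUP n. ereal (W n \<omega>))"
    unfolding sup_W_def by (cases "SUP n. ereal (W n \<omega>)") auto
  then have "x < sup_W \<omega> \<longleftrightarrow> ereal x < (SUP n. ereal (W n \<omega>))" by (metis less_ereal.simps(1))
  then show ?thesis by (simp add: less_SUP_iff)
qed

lemma AE_sup_W: "AE \<omega> in M. 0 \<le> sup_W \<omega> \<and> (\<forall>x. x < sup_W \<omega> \<longleftrightarrow> (\<exists>n. x < W n \<omega>))"
  using AE_bounded W_0
proof eventually_elim
  case (elim \<omega>)
  then show ?case using sup_W_greater_iff[OF elim(1)] by (metis not_less order_less_irrefl)
qed

lemma prob_sup_W_greater: "prob {\<omega> \<in> space M. x < sup_W \<omega>} = hit x"
  by (rule finite_measure_eq_AE) (use AE_sup_W in \<open>auto elim!: AE_mp\<close>)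

definition sup_law :: "real \<Rightarrow> real measure" where
  "sup_law u = distr M borel (\<lambda>\<omega>. sup_W \<omega> / u)"

lemma measure_sup_law:
  "\<Gamma> \<in> sets borel \<Longrightarrow> measure (sup_law u) \<Gamma> = prob {\<omega> \<in> space M. sup_W \<omega> / u \<in> \<Gamma>}"
  unfolding sup_law_def by (subst measure_distr) (auto intro!: arg_cong[where f = prob])

lemma visit_prob_eq:
  assumes "u > 0"
  shows "visit_prob M W u \<Gamma> = prob {\<omega> \<in> space M. \<exists>n. W n \<omega> / u \<in> \<Gamma>}"
proof -
  have "w \<in> (\<lambda>x. u * x) ` \<Gamma> \<longleftrightarrow> w / u \<in> \<Gamma>" for w
    using assms by (auto simp: image_iff intro: bexI[of _ "w / u"])
  then show ?thesis by (simp add: visit_prob_def)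
qed

lemma visit_measure_sup_law: "visit_measure M W sup_law"
  unfolding visit_measure_def
proof (intro allI impI conjI)
  fix u x :: real assume u: "u > 0"
  show "prob_space (sup_law u)" unfolding sup_law_def by (rule prob_space_distr) simp
  show "sets (sup_law u) = sets borel" by (simp add: sup_law_def)
  have "measure (sup_law u) {x<..} = prob {\<omega> \<in> space M. x * u < sup_W \<omega>}"
    using u by (simp add: measure_sup_law less_divide_eq)
  also have "\<dots> = visit_prob M W u {x<..}"
    using u by (simp add: prob_sup_W_greater visit_prob_eq less_divide_eq)
  finally show "measure (sup_law u) {x<..} = visit_prob M W u {x<..}" .
qed

section \<open>From half-lines and windows to Borel sets\<close>

abbreviation I :: "real \<Rightarrow> ereal" where "I \<equiv> rate_fun A V J"

lemma rate_fun_eq: "I x = (if 0 \<le> x then ereal (\<kappa> * x powr (V / A)) else \<infinity>)"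
  by (simp add: rate_fun_def rate_const_eq)

text \<open>Compactness of the level sets rests on \<open>\<kappa> > 0\<close>.\<close>

lemma good_rate_function_rate_fun: "good_rate_function I"
  unfolding good_rate_function_def
proof (intro conjI allI impI)
  show "0 \<le> I x" for x using \<kappa>_pos by (simp add: rate_fun_eq)
  show "\<exists>x. I x \<noteq> \<infinity>" by (rule exI[of _ 0]) (simp add: rate_fun_eq)
  show "I x \<le> Liminf (at x) I" for x
    unfolding le_Liminf_iff
  proof (intro allI impI)
    fix y assume y: "y < I x"
    have cont: "((\<lambda>t. ereal (\<kappa> * t powr (V / A))) \<longlongrightarrow> ereal (\<kappa> * x powr (V / A))) (at x)" if "0 < x"
      using that by (intro tendsto_intros tendsto_ereal) auto
    consider "x < 0" | "x = 0" | "0 < x" by linarith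
    then show "\<forall>\<^sub>F t in at x. y < I t"
    proof cases
      case 3
      then have "\<forall>\<^sub>F t in at x. y < ereal (\<kappa> * t powr (V / A))"
        using order_tendstoD(1)[OF cont] y by (simp add: rate_fun_eq)
      then show ?thesis by eventually_elim (auto simp: rate_fun_eq less_le_trans)
    next
      case 2
      then have "y < 0" using y by (simp add: rate_fun_eq flip: zero_ereal_def)
      then show ?thesis using \<kappa>_pos by (intro always_eventually) (auto simp: rate_fun_eq intro: less_le_trans)
    next
      case 1
      then have "\<forall>\<^sub>F t in at x. t < 0" by (intro order_tendstoD(2)[OF tendsto_ident_at]) auto
      then show ?thesis by eventually_elim (use y 1 in \<open>simp add: rate_fun_eq\<close>)
    qed
  qed
  fix r :: real assume r: "0 \<le> r"
  have "{x. I x \<le> ereal r} = {0..(r / \<kappa>) powr (1 / (V / A))}"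
  proof -
    have "\<kappa> * x powr (V / A) \<le> r \<longleftrightarrow> x \<le> (r / \<kappa>) powr (1 / (V / A))" if x: "0 \<le> x" for x
    proof -
      let ?y = "(r / \<kappa>) powr (1 / (V / A))"
      have "?y powr (V / A) = r / \<kappa>"
        using r \<kappa>_pos by (intro powr_inverse_powr exponent_pos) simp
      moreover have "\<kappa> * x powr (V / A) \<le> r \<longleftrightarrow> x powr (V / A) \<le> r / \<kappa>"
        using \<kappa>_pos by (simp add: pos_le_divide_eq mult.commute)
      moreover have "x powr (V / A) \<le> ?y powr (V / A) \<longleftrightarrow> x \<le> ?y"
        using powr_mono2[of "V / A" x ?y] powr_less_mono2[of "V / A" ?y x] exponent_pos x
        by (meson less_imp_le not_less powr_ge_zero)
      ultimately show ?thesis by simp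
    qed
    then show ?thesis by (auto simp: rate_fun_eq split: if_splits)
  qed
  then show "compact {x. I x \<le> ereal r}" by simp
qed

text \<open>Only positive points of the interior have to be examined: negative points have infinite rate, and
  if \<open>0\<close> is an interior point then so are small positive points, whose rates tend to \<open>0\<close>.\<close>

lemma LD_lower_boundI:
  assumes lower: "\<And>x \<theta>. 0 < x \<Longrightarrow> x \<in> interior \<Gamma> \<Longrightarrow> \<kappa> * x powr (V / A) < \<theta> \<Longrightarrow>
    \<forall>\<^sub>F u in at_top. exp (- (\<theta> * h u)) \<le> P u \<Gamma>"
  shows "LD_lower_bound h I P \<Gamma>"
proof -
  define L where "L = Liminf at_top (\<lambda>u. ereal (1 / h u) * log_prob (P u \<Gamma>))"
  have pos: "- L \<le> I x" if x: "0 < x" "x \<in> interior \<Gamma>" for x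
  proof -
    have "ereal (- (\<kappa> * x powr (V / A))) \<le> L"
      unfolding L_def le_Liminf_iff
    proof (intro allI impI)
      fix y assume "y < ereal (- (\<kappa> * x powr (V / A)))"
      then obtain r where r: "y < ereal r" "ereal r < ereal (- (\<kappa> * x powr (V / A)))"
        using ereal_dense2 by blast
      have "\<forall>\<^sub>F u in at_top. exp (- (- r * h u)) \<le> P u \<Gamma>" using x r by (intro lower) auto
      then show "\<forall>\<^sub>F u in at_top. y < ereal (1 / h u) * log_prob (P u \<Gamma>)" using speed_pos
      proof eventually_elim
        case (elim u)
        then have "ereal (- (- r)) \<le> ereal (1 / h u) * log_prob (P u \<Gamma>)"
          using log_rate_ge_iff by blast
        with r show ?case by simp
      qed
    qed
    then show ?thesis using x by (cases L) (auto simp: rate_fun_eq)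
  qed
  have "- L \<le> I x" if x: "x \<in> interior \<Gamma>" for x
  proof -
    consider "x < 0" | "x = 0" | "x > 0" by linarith
    then show ?thesis
    proof cases
      case 2
      have "((\<lambda>t. ereal (\<kappa> * t powr (V / A))) \<longlongrightarrow> ereal (\<kappa> * 0 powr (V / A))) (at_right 0)"
        using exponent_pos eventually_at_right_less[of "0 :: real"]
        by (intro tendsto_intros tendsto_ereal tendsto_powr2) (auto elim: eventually_mono)
      moreover have "\<forall>\<^sub>F t in at_right 0. - L \<le> ereal (\<kappa> * t powr (V / A))"
      proof -
        have "\<forall>\<^sub>F t in at_right 0. t \<in> interior \<Gamma>"
          using x 2 open_interior topological_tendstoD[OF tendsto_ident_at] by blast
        then show ?thesis using eventually_at_right_less[of 0]
        proof eventually_elim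
          case (elim t)
          then show ?case using pos[of t] by (simp add: rate_fun_eq)
        qed
      qed
      ultimately have "- L \<le> ereal (\<kappa> * 0 powr (V / A))"
        by (rule tendsto_lowerbound) simp
      then show ?thesis using 2 by (simp add: rate_fun_eq)
    qed (use pos x in \<open>auto simp: rate_fun_eq\<close>)
  qed
  then have "- L \<le> (INF x\<in>interior \<Gamma>. I x)" by (intro INF_greatest)
  then show ?thesis unfolding LD_lower_bound_def L_def[symmetric]
    using ereal_uminus_le_reorder by blast
qed

text \<open>If \<open>\<theta>'\<close> is below the infimum of the rate function over \<open>closure \<Gamma>\<close>, then \<open>closure \<Gamma>\<close> has no
  point in \<open>{0..x}\<close> for the \<open>x\<close> with \<open>\<kappa> * x powr (V / A) = \<theta>'\<close>. It thus suffices to compare with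
  the probability of exceeding \<open>x * u\<close>. The hypothesis is vacuous if \<open>0 \<in> closure \<Gamma>\<close>.\<close>

lemma LD_upper_boundI:
  assumes le_1: "\<And>u. P u \<Gamma> \<le> 1"
    and upper: "\<And>x. 0 < x \<Longrightarrow> closure \<Gamma> \<inter> {0..} \<subseteq> {x<..} \<Longrightarrow> \<forall>\<^sub>F u in at_top. P u \<Gamma> \<le> hit (x * u)"
  shows "LD_upper_bound h I P \<Gamma>"
proof -
  define L where "L = Limsup at_top (\<lambda>u. ereal (1 / h u) * log_prob (P u \<Gamma>))"
  have L: "L \<le> ereal (- \<theta>)" if "\<forall>\<^sub>F u in at_top. P u \<Gamma> \<le> exp (- (\<theta> * h u))" for \<theta>
    unfolding L_def
  proof (rule Limsup_bounded)
    show "\<forall>\<^sub>F u in at_top. ereal (1 / h u) * log_prob (P u \<Gamma>) \<le> ereal (- \<theta>)"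
      using that speed_pos by eventually_elim (simp add: log_rate_le_iff)
  qed
  have "(INF x\<in>closure \<Gamma>. I x) \<le> - L"
  proof (rule dense_le)
    fix y assume "y < (INF x\<in>closure \<Gamma>. I x)"
    then obtain \<theta> where \<theta>: "y < ereal \<theta>" "ereal \<theta> < (INF x\<in>closure \<Gamma>. I x)"
      using ereal_dense2 by blast
    then obtain \<theta>' where \<theta>': "ereal \<theta> < ereal \<theta>'" "ereal \<theta>' < (INF x\<in>closure \<Gamma>. I x)"
      using ereal_dense2 by blast
    have "L \<le> ereal (- \<theta>)"
    proof (cases "\<theta> \<le> 0")
      case True
      have "L \<le> ereal (- 0)" using le_1 by (intro L) simp
      also have "\<dots> \<le> ereal (- \<theta>)" using True by simp
      finally show ?thesis .
    next
      case False
      define x where "x = (\<theta>' / \<kappa>) powr (1 / (V / A))"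
      have "\<theta>' / \<kappa> > 0" using False \<theta>' \<kappa>_pos by simp
      then have "x > 0" "x powr (V / A) = \<theta>' / \<kappa>"
        using powr_inverse_powr[OF _ exponent_pos] unfolding x_def by auto
      then have x: "x > 0" "\<kappa> * x powr (V / A) = \<theta>'" using \<kappa>_pos by simp_all
      have "closure \<Gamma> \<inter> {0..} \<subseteq> {x<..}"
      proof (rule ccontr)
        assume "\<not> closure \<Gamma> \<inter> {0..} \<subseteq> {x<..}"
        then obtain z where "z \<in> closure \<Gamma>" "z \<in> {0..}" "z \<notin> {x<..}" by blast
        then have z: "z \<in> closure \<Gamma>" "0 \<le> z" "z \<le> x" by auto
        have "\<kappa> * z powr (V / A) \<le> \<theta>'"
          unfolding x(2)[symmetric] using z exponent_pos \<kappa>_pos by (intro mult_left_mono powr_mono2) auto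
        then have "I z \<le> ereal \<theta>'" using z by (simp add: rate_fun_eq)
        moreover have "(INF x\<in>closure \<Gamma>. I x) \<le> I z" using z by (intro INF_lower)
        ultimately show False using \<theta>'(2) by (meson leD order_trans)
      qed
      from upper[OF x(1) this] hit_upper[OF x(1), of \<theta>]
      have "\<forall>\<^sub>F u in at_top. P u \<Gamma> \<le> hit (x * u)" "\<forall>\<^sub>F u in at_top. hit (x * u) \<le> exp (- (\<theta> * h u))"
        using x \<theta>' by auto
      then have "\<forall>\<^sub>F u in at_top. P u \<Gamma> \<le> exp (- (\<theta> * h u))"
        by eventually_elim (rule order_trans)
      then show ?thesis by (rule L)
    qed
    then have "ereal \<theta> \<le> - L" by (cases L) auto
    with \<theta>(1) show "y \<le> - L" by simp
  qed
  then have "L \<le> - (INF x\<in>closure \<Gamma>. I x)" by (metis ereal_minus_le_minus ereal_uminus_uminus)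
  then show ?thesis unfolding LD_upper_bound_def L_def
    by (simp add: Liminf_le_Limsup)
qed

lemma visit_prob_LD_lower_bound:
  assumes [measurable]: "\<Gamma> \<in> sets borel"
  shows "LD_lower_bound h I (visit_prob M W) \<Gamma>"
proof (rule LD_lower_boundI)
  fix x \<theta> :: real assume x: "0 < x" "x \<in> interior \<Gamma>" and \<theta>: "\<kappa> * x powr (V / A) < \<theta>"
  obtain y z where yz: "0 \<le> y" "y < x" "x < z" "{y<..<z} \<subseteq> \<Gamma>" by (rule interior_window[OF x(2,1)])
  show "\<forall>\<^sub>F u in at_top. exp (- (\<theta> * h u)) \<le> visit_prob M W u \<Gamma>"
    using window_lower[OF yz(1,2,3) \<theta>] eventually_gt_at_top[of 0]
  proof eventually_elim
    case (elim u)
    note elim(1)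
    also have "prob {\<omega> \<in> space M. \<exists>n. y * u < W n \<omega> \<and> W n \<omega> < z * u}
      \<le> prob {\<omega> \<in> space M. \<exists>n. W n \<omega> / u \<in> \<Gamma>}"
    proof (rule finite_measure_mono)
      show "{\<omega> \<in> space M. \<exists>n. y * u < W n \<omega> \<and> W n \<omega> < z * u} \<subseteq> {\<omega> \<in> space M. \<exists>n. W n \<omega> / u \<in> \<Gamma>}"
      proof safe
        fix \<omega> n assume "y * u < W n \<omega>" "W n \<omega> < z * u"
        then have "W n \<omega> / u \<in> {y<..<z}" using elim(2) by (simp add: field_simps)
        then show "\<exists>n. W n \<omega> / u \<in> \<Gamma>" using yz(4) by blast
      qed
    qed measurable
    finally show ?case using elim(2) by (simp add: visit_prob_eq)
  qed
qed

text \<open>The process may visit the negative part of \<open>u * \<Gamma>\<close> at no exponential cost, whereas negative points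
  have infinite rate. This does not matter if \<open>\<Gamma>\<close> has no negative points or if the bound is trivial
  because \<open>0 \<in> closure \<Gamma>\<close>.\<close>

lemma visit_prob_LD_upper_bound:
  assumes "\<Gamma> \<subseteq> {0..} \<or> 0 \<in> closure \<Gamma>"
  shows "LD_upper_bound h I (visit_prob M W) \<Gamma>"
proof (rule LD_upper_boundI)
  show "visit_prob M W u \<Gamma> \<le> 1" for u by (simp add: visit_prob_def)
  fix x :: real assume x: "0 < x" "closure \<Gamma> \<inter> {0..} \<subseteq> {x<..}"
  then have "0 \<notin> closure \<Gamma>" by auto
  with assms x(2) closure_subset[of \<Gamma>] have \<Gamma>: "\<Gamma> \<subseteq> {x<..}" by blast
  show "\<forall>\<^sub>F u in at_top. visit_prob M W u \<Gamma> \<le> hit (x * u)"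
    using eventually_gt_at_top[of 0]
  proof eventually_elim
    case (elim u)
    have "prob {\<omega> \<in> space M. \<exists>n. W n \<omega> / u \<in> \<Gamma>} \<le> hit (x * u)"
    proof (rule finite_measure_mono)
      show "{\<omega> \<in> space M. \<exists>n. W n \<omega> / u \<in> \<Gamma>} \<subseteq> {\<omega> \<in> space M. \<exists>n. x * u < W n \<omega>}"
      proof safe
        fix \<omega> n assume "W n \<omega> / u \<in> \<Gamma>"
        then have "x < W n \<omega> / u" using \<Gamma> by auto
        then show "\<exists>n. x * u < W n \<omega>" using elim by (auto simp: field_simps)
      qed
    qed measurable
    then show ?case using elim by (simp add: visit_prob_eq)
  qed
qed

text \<open>Here a visit to the window is not enough, since the supremum may lie beyond it. A visit gives only
  that the supremum exceeds \<open>y * u\<close>; that it also exceeds \<open>z' * u\<close> for some \<open>z' > x\<close> is of smaller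
  exponential order by the upper bound.\<close>

lemma sup_law_LD_lower_bound:
  assumes [measurable]: "\<Gamma> \<in> sets borel"
  shows "LD_lower_bound h I (\<lambda>u. measure (sup_law u)) \<Gamma>"
proof (rule LD_lower_boundI)
  fix x \<theta> :: real assume x: "0 < x" "x \<in> interior \<Gamma>" and \<theta>: "\<kappa> * x powr (V / A) < \<theta>"
  obtain y z where yz: "0 \<le> y" "y < x" "x < z" "{y<..<z} \<subseteq> \<Gamma>" by (rule interior_window[OF x(2,1)])
  obtain z' where z': "x < z'" "z' < z" using dense yz by blast
  have "\<kappa> * x powr (V / A) < \<kappa> * z' powr (V / A)"
    using \<kappa>_pos exponent_pos x z' by (intro mult_strict_left_mono powr_less_mono2) auto
  then obtain \<beta> where \<beta>: "\<kappa> * x powr (V / A) < \<beta>" "\<beta> < \<kappa> * z' powr (V / A)" using dense by blast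
  obtain \<alpha> where \<alpha>: "\<kappa> * x powr (V / A) < \<alpha>" "\<alpha> < \<beta>" "\<alpha> < \<theta>"
    using dense[of "\<kappa> * x powr (V / A)" "min \<beta> \<theta>"] \<beta> \<theta> by auto
  have "z' > 0" using x z' by simp
  show "\<forall>\<^sub>F u in at_top. exp (- (\<theta> * h u)) \<le> measure (sup_law u) \<Gamma>"
    using window_lower[OF yz(1,2,3) \<alpha>(1)] hit_upper[OF \<open>z' > 0\<close> \<beta>(2)]
      eventually_exp_le_diff[OF speed_at_top \<alpha>(2,3)] eventually_gt_at_top[of 0]
  proof eventually_elim
    case (elim u)
    have "prob {\<omega> \<in> space M. \<exists>n. y * u < W n \<omega> \<and> W n \<omega> < z * u} \<le> hit (y * u)"
      by (rule finite_measure_mono) auto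
    then have "exp (- (\<theta> * h u)) \<le> hit (y * u) - hit (z' * u)" using elim(1,2,3) by linarith
    also have "\<dots> = prob ({\<omega> \<in> space M. y * u < sup_W \<omega>} - {\<omega> \<in> space M. z' * u < sup_W \<omega>})"
    proof (subst finite_measure_Diff)
      have "y * u \<le> z' * u" using yz z' elim(4) by (intro mult_right_mono) auto
      then show "{\<omega> \<in> space M. z' * u < sup_W \<omega>} \<subseteq> {\<omega> \<in> space M. y * u < sup_W \<omega>}" by auto
    qed (auto simp: prob_sup_W_greater)
    also have "\<dots> \<le> prob {\<omega> \<in> space M. sup_W \<omega> / u \<in> \<Gamma>}"
    proof (rule finite_measure_mono)
      show "{\<omega> \<in> space M. y * u < sup_W \<omega>} - {\<omega> \<in> space M. z' * u < sup_W \<omega>}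
          \<subseteq> {\<omega> \<in> space M. sup_W \<omega> / u \<in> \<Gamma>}"
      proof safe
        fix \<omega> assume "y * u < sup_W \<omega>" "\<not> z' * u < sup_W \<omega>"
        then have "y < sup_W \<omega> / u" "sup_W \<omega> / u \<le> z'" using elim(4) by (simp_all add: field_simps)
        then show "sup_W \<omega> / u \<in> \<Gamma>" using z' yz(4) by auto
      qed
    qed measurable
    finally show ?case by (simp add: measure_sup_law)
  qed
qed

lemma sup_law_LD_upper_bound:
  assumes [measurable]: "\<Gamma> \<in> sets borel"
  shows "LD_upper_bound h I (\<lambda>u. measure (sup_law u)) \<Gamma>"
proof (rule LD_upper_boundI)
  show "measure (sup_law u) \<Gamma> \<le> 1" for u by (simp add: measure_sup_law)
  fix x :: real assume x: "0 < x" "closure \<Gamma> \<inter> {0..} \<subseteq> {x<..}"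
  show "\<forall>\<^sub>F u in at_top. measure (sup_law u) \<Gamma> \<le> hit (x * u)"
    using eventually_gt_at_top[of 0]
  proof eventually_elim
    case (elim u)
    have "prob {\<omega> \<in> space M. sup_W \<omega> / u \<in> \<Gamma>} \<le> prob {\<omega> \<in> space M. x * u < sup_W \<omega>}"
    proof (rule finite_measure_mono_AE)
      show "AE \<omega> in M. \<omega> \<in> {\<omega> \<in> space M. sup_W \<omega> / u \<in> \<Gamma>} \<longrightarrow> \<omega> \<in> {\<omega> \<in> space M. x * u < sup_W \<omega>}"
        using AE_sup_W
      proof eventually_elim
        case nonneg: (elim \<omega>)
        show ?case
        proof safe
          assume "sup_W \<omega> / u \<in> \<Gamma>"
          moreover have "0 \<le> sup_W \<omega> / u" using nonneg elim by simp
          ultimately have "x < sup_W \<omega> / u" using x(2) closure_subset[of \<Gamma>] by auto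
          then show "x * u < sup_W \<omega>" using elim by (simp add: field_simps)
        qed
      qed
    qed measurable
    then show ?case by (simp add: measure_sup_law prob_sup_W_greater)
  qed
qed

lemma LDP_sup_law: "LDP h I sup_law"
  unfolding LDP_def
  by (auto intro: good_rate_function_rate_fun sup_law_LD_lower_bound sup_law_LD_upper_bound)

end

theorem theorem4:
  fixes a v :: "real \<Rightarrow> real" and A V q :: real
    and M :: "'s measure" and W :: "nat \<Rightarrow> 's \<Rightarrow> real"
    and J :: "real \<Rightarrow> ereal"
  assumes "continuous_on {0..} a" and "strict_mono_on {0..} a" and "\<forall>t\<ge>0. 0 \<le> a t"
    and "continuous_on {0..} v" and "strict_mono_on {0..} v" and "\<forall>t\<ge>0. 0 \<le> v t"
    and "A > 0" and "regularly_varying a A"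
    and "V > 0" and "regularly_varying v V"
    and "prob_space M" and "\<forall>n. W n \<in> borel_measurable M" and "AE \<omega> in M. W 0 \<omega> = 0"
    and "\<forall>x\<ge>0. 0 \<le> J x"
    and "restricted_LDP M W a v J"
    and "stable_and_continuous J"
    and "q > 0" and "\<exists>F>V / A. \<exists>K>0. uniform_individual_decay M W a v q F K"
  shows "(\<exists>\<mu>. visit_measure M W \<mu> \<and> LDP (ldp_speed a v) (rate_fun A V J) \<mu>) \<and>
         (\<forall>\<Gamma>\<in>sets borel.
            LD_lower_bound (ldp_speed a v) (rate_fun A V J) (visit_prob M W) \<Gamma> \<and>
            (\<Gamma> \<subseteq> {0..} \<or> 0 \<in> closure \<Gamma> \<longrightarrow>
              LD_upper_bound (ldp_speed a v) (rate_fun A V J) (visit_prob M W) \<Gamma>))"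
proof -
  obtain F K where FK: "F > V / A" "K > 0" "uniform_individual_decay M W a v q F K"
    using assms(18) by blast
  have J: "0 < J 0" "\<exists>y>0. J y < \<infinity>"
    using assms(16) by (simp_all add: stable_and_continuous_def)
  interpret scaling_pair a v A V
    by (rule scaling_pair.intro) (use assms in auto)
  interpret prob_space M by (rule assms(11))
  interpret visiting_process a v A V M W J q F K
    by unfold_locales (use assms FK J in auto)
  show ?thesis
    using visit_measure_sup_law LDP_sup_law visit_prob_LD_lower_bound visit_prob_LD_upper_bound by blast
qed

end
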